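(* Let $p=5$, let $X$ be the one-vertex symmetric digraph with three inverse pairs of loops $s_i,\bar s_i$ ($i=0,1,2$), with voltage assignment $\alpha:E(X)\to\mathbb Z_5$ given by $\alpha(s_0)=1$, $\alpha(s_1)=\alpha(s_2)=0$, $\alpha(\bar s_i)=-\alpha(s_i)$, and let $U_n$ be the Grover transition matrix on the $n$-th layer $X_n$ of the tower. Put \[ P_5(A)=A^4-\tfrac73A^3+\tfrac{29}{9}A^2-\tfrac73A+1\in\mathbb Z_5[A]. \] Then $P_5(1)=\frac59$ and $P_5(-1)=\frac{89}{9}$, so $P_5$ is coprime to $A^2-1$. Moreover, \[ \mathcal R_{X,P_5}(T)=\frac{\Phi_5(z)^2}{81z^4},\qquad z=1+T, \] where $\Phi_5$ is the fifth cyclotomic polynomial. As a power series over $\mathbb Z_5$ it satisfies \[ \mu(\mathcal R_{X,P_5})=0,\qquad\lambda(\mathcal R_{X,P_5})=8 . \] Consequently, for $\zeta\in\mu_{5^\infty}$, $\mathcal R_{X,P_5}(\zeta-1)=0$ if and only if $\zeta$ is a primitive fifth root of unity (so the condition $\mathcal R_{X,P_5}(\zeta-1)\ne0$ for all $\zeta\in\mu_{5^\infty}$ fails). The roots of $P_5$ occur as eigenvalues of $U_n$ on every level containing the primitive fifth characters, in particular for every $n\ge1$.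
   Context: A symmetric digraph has directed edges with origin $o(e)$, terminus $t(e)$ and inversion $e\mapsto\bar e\ne e$; $d_v=\#\{e:o(e)=v\}$ and the Grover weight is $w(e)=2/d_{o(e)}$ (here $1/3$). $X_n$ has vertex set $V(X)\times\mathbb Z/5^n$ and edges $(e,g):(o(e),g)\to(t(e),g+\alpha(e))$, with inverse $(\bar e,g+\alpha(e))$. The Grover transition matrix $U_n$, indexed by the directed edges of $X_n$, has $(U_n)_{e,f}=\frac{2}{d_{t(f)}}-\delta_{f,\bar e}$ if $t(f)=o(e)$ and $0$ otherwise. The characters of level $n$ correspond to $\mu_{5^n}(\overline{\mathbb Q}_5)$, and $\mu_{5^\infty}=\bigcup_n\mu_{5^n}(\overline{\mathbb Q}_5)$; level $n$ contains the primitive fifth characters when $n\ge1$. Since $X$ has one vertex, its spectral polynomial is $\mathcal F_X(A,T)=A^2+1-\frac A3(z+z^{-1}+4)$ with $z=1+T$. $\mathcal R_{X,P}(T)=\operatorname{Res}_A(\mathcal F_X(A,T),P(A))$, where $\operatorname{Res}_A(f,g)=\prod_ig(\alpha_i)$ for monic $f=\prod_i(A-\alpha_i)$ over an algebraically closed field; $\mathcal R_{X,P}(\zeta-1)$ is evaluation at $T=\zeta-1$. For nonzero $F=5^NF_0$ with $F_0\in\mathbb Z_5[[T]]$, $5\nmid F_0$: $\mu(F)=N$ and $\lambda(F)=\operatorname{ord}_{T}(\overline F_0)$, the $T$-adic order of the reduction $\overline F_0\in\mathbb F_5[[T]]$. *)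

theory Defs
  imports
    "HOL-Algebra.Algebraic_Closure_Type"
    "HOL-Computational_Algebra.Computational_Algebra"
    "Berlekamp_Zassenhaus.Finite_Field"
    "Jordan_Normal_Form.Char_Poly"
    "Graph_Theory.Bidirected_Digraph"
begin

section \<open>The p-adic integers\<close>

text \<open>The prime $p$ is the cardinality of a type of class \<^class>\<open>prime_card\<close>, as for
  \<^typ>\<open>'p mod_ring\<close>. A $p$-adic integer is a coherent sequence of residues: an element of the
  inverse limit of the rings $\mathbb Z/p^n$.\<close>

typedef ('p :: prime_card) padic_int =
  "{x :: nat \<Rightarrow> int. \<forall>n. x n \<in> {0..<int CARD('p) ^ n} \<and> x (Suc n) mod int CARD('p) ^ n = x n}"
  morphisms padic_res Abs_padic_int
  by (rule exI[of _ "\<lambda>_. 0"]) auto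

setup_lifting type_definition_padic_int

lemma padic_res_range: "padic_res (x :: 'p :: prime_card padic_int) n \<in> {0..<int CARD('p) ^ n}"
  using padic_res[of x] by auto

lemma padic_res_Suc:
  "padic_res (x :: 'p :: prime_card padic_int) (Suc n) mod int CARD('p) ^ n = padic_res x n"
  using padic_res[of x] by auto

lemma padic_res_mod [simp]:
  "padic_res (x :: 'p :: prime_card padic_int) n mod int CARD('p) ^ n = padic_res x n"
  using padic_res_range[of x n] by simp

lemma padic_res_add_mod:
  "padic_res (x :: 'p :: prime_card padic_int) (n + k) mod int CARD('p) ^ n = padic_res x n"
proof (induction k)
  case (Suc k)
  have "padic_res x (Suc (n + k)) mod int CARD('p) ^ n
      = padic_res x (Suc (n + k)) mod int CARD('p) ^ (n + k) mod int CARD('p) ^ n"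
    by (simp add: mod_mod_cancel le_imp_power_dvd)
  thus ?case using Suc by (simp add: padic_res_Suc)
qed simp

lemma mod_Suc_power_mod: "x mod int CARD('p :: prime_card) ^ Suc n mod int CARD('p) ^ n = x mod int CARD('p) ^ n"
  by (rule mod_mod_cancel) simp

instantiation padic_int :: (prime_card) comm_ring_1
begin

lift_definition zero_padic_int :: "'a padic_int" is "\<lambda>_. 0"
  by auto

lift_definition one_padic_int :: "'a padic_int" is "\<lambda>n. 1 mod int CARD('a) ^ n"
  by (simp only: mod_Suc_power_mod) simp

lift_definition plus_padic_int :: "'a padic_int \<Rightarrow> 'a padic_int \<Rightarrow> 'a padic_int"
  is "\<lambda>x y n. (x n + y n) mod int CARD('a) ^ n"
  by (simp only: mod_Suc_power_mod) (simp, metis mod_add_eq)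

lift_definition times_padic_int :: "'a padic_int \<Rightarrow> 'a padic_int \<Rightarrow> 'a padic_int"
  is "\<lambda>x y n. (x n * y n) mod int CARD('a) ^ n"
  by (simp only: mod_Suc_power_mod) (simp, metis mod_mult_eq)

lift_definition uminus_padic_int :: "'a padic_int \<Rightarrow> 'a padic_int"
  is "\<lambda>x n. (- x n) mod int CARD('a) ^ n"
  by (simp only: mod_Suc_power_mod) (simp, metis mod_minus_eq)

lift_definition minus_padic_int :: "'a padic_int \<Rightarrow> 'a padic_int \<Rightarrow> 'a padic_int"
  is "\<lambda>x y n. (x n - y n) mod int CARD('a) ^ n"
  by (simp only: mod_Suc_power_mod) (simp, metis mod_diff_eq)

instance
proof
  fix a b c :: "'a padic_int"
  show "a * b * c = a * (b * c)"
    by transfer (auto simp: fun_eq_iff mod_simps mult.assoc)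
  show "a * b = b * a"
    by transfer (auto simp: fun_eq_iff mult.commute)
  show "1 * a = a"
    by transfer (auto simp: fun_eq_iff mod_simps)
  show "a + b + c = a + (b + c)"
    by transfer (auto simp: fun_eq_iff mod_simps add.assoc)
  show "a + b = b + a"
    by transfer (auto simp: fun_eq_iff add.commute)
  show "0 + a = a"
    by transfer (auto simp: fun_eq_iff)
  show "- a + a = 0"
    by transfer (auto simp: fun_eq_iff mod_simps)
  show "a - b = a + - b"
    by transfer (auto simp: fun_eq_iff mod_simps)
  show "(a + b) * c = a * c + b * c"
    by transfer (auto simp: fun_eq_iff mod_simps distrib_right)
  show "(0 :: 'a padic_int) \<noteq> 1"
  proof transfer
    have "int CARD('a) > 1"
      using prime_gt_1_int[OF prime_card_int] by simp
    hence "1 mod int CARD('a) ^ 1 = 1"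
      by simp
    thus "(\<lambda>_. 0) \<noteq> (\<lambda>n. 1 mod int CARD('a) ^ n)"
      by (metis zero_neq_one)
  qed
qed

end

lemma padic_res_eq_0_iff:
  "padic_res (x :: 'p :: prime_card padic_int) n = 0 \<longleftrightarrow> int CARD('p) ^ n dvd padic_res x (n + k)"
  by (metis padic_res_add_mod dvd_eq_mod_eq_0)

instance padic_int :: (prime_card) idom
proof
  fix a b :: "'a padic_int"
  assume "a \<noteq> 0" "b \<noteq> 0"
  then obtain n m where n: "padic_res a n \<noteq> 0" and m: "padic_res b m \<noteq> 0"
    by transfer (auto simp: fun_eq_iff)
  define p where "p = int CARD('a)"
  define u v where "u = padic_res a (n + m)" and "v = padic_res b (n + m)"
  have p: "prime_elem p"
    unfolding p_def using prime_card_int by (rule prime_imp_prime_elem)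
  have u: "\<not> p ^ n dvd u" and v: "\<not> p ^ m dvd v"
    using n m padic_res_eq_0_iff[of a n m] padic_res_eq_0_iff[of b m n]
    by (simp_all add: p_def u_def v_def add.commute)
  have uv: "u \<noteq> 0" "v \<noteq> 0"
    using u v by auto
  have pu: "\<not> is_unit p"
    using p by auto
  have "\<not> p ^ (n + m) dvd u * v"
    using u v uv p pu
    by (simp add: power_dvd_iff_le_multiplicity prime_elem_multiplicity_mult_distrib)
  hence "padic_res (a * b) (n + m) \<noteq> 0"
    by (simp add: times_padic_int.rep_eq u_def v_def p_def dvd_eq_mod_eq_0)
  thus "a * b \<noteq> 0"
    by (auto simp: zero_padic_int.rep_eq)
qed

text \<open>Division by units, so that $7/3$ can be read in $\mathbb Z_5$; as for power series, the
  inverse of a non-unit is $0$.\<close>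

instantiation padic_int :: (prime_card) inverse
begin

definition inverse_padic_int :: "'a padic_int \<Rightarrow> 'a padic_int" where
  "inverse_padic_int x = (if x dvd 1 then (THE y. x * y = 1) else 0)"

definition divide_padic_int :: "'a padic_int \<Rightarrow> 'a padic_int \<Rightarrow> 'a padic_int" where
  "divide_padic_int x y = x * inverse y"

instance ..

end

lemma padic_unit_inverse:
  assumes "(x :: 'p :: prime_card padic_int) dvd 1"
  shows "x * inverse x = 1"
proof -
  from assms obtain y where y: "x * y = 1"
    by (metis dvdE)
  hence "(THE y. x * y = 1) = y"
    by (intro the_equality) (metis mult.assoc mult.commute mult_1)+
  thus ?thesis using y assms by (simp add: inverse_padic_int_def)
qed

typedef five = "{0..<5 :: nat}"
  by (rule exI[of _ 0]) auto

lemma CARD_five: "CARD(five) = 5"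
  using type_definition.card[OF type_definition_five] by simp

instance five :: prime_card
  by standard (simp add: CARD_five)

type_synonym Z5 = "five padic_int"
type_synonym F5 = "five mod_ring"
type_synonym Q5 = "five padic_int fract"
type_synonym Q5_bar = "five padic_int fract alg_closure"


section \<open>Power series over the p-adic integers\<close>

definition fps_mod_p :: "'p :: prime_card padic_int fps \<Rightarrow> 'p mod_ring fps" where
  "fps_mod_p F = Abs_fps (\<lambda>i. of_int (padic_res (fps_nth F i) 1))"

definition mu_inv :: "'p :: prime_card padic_int fps \<Rightarrow> nat" where
  "mu_inv F = (THE N. \<exists>F0. F = of_nat CARD('p) ^ N * F0 \<and> \<not> of_nat CARD('p) dvd F0)"

definition lambda_inv :: "'p :: prime_card padic_int fps \<Rightarrow> nat" where
  "lambda_inv F = (THE l. \<exists>N F0. F = of_nat CARD('p) ^ N * F0 \<and> \<not> of_nat CARD('p) dvd F0 \<and>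
     l = subdegree (fps_mod_p F0))"


section \<open>Evaluation of power series over the algebraic closure\<close>

abbreviation to_qbar :: "'p :: prime_card padic_int \<Rightarrow> 'p padic_int fract alg_closure" where
  "to_qbar c \<equiv> to_ac (to_fract c)"

definition qbar_integers :: "'p :: prime_card padic_int fract alg_closure set" where
  "qbar_integers = {x. \<exists>f :: 'p padic_int poly. lead_coeff f = 1 \<and> poly (map_poly to_qbar f) x = 0}"

text \<open>Convergence for the $p$-adic absolute value: the integral closure $O$ of $\mathbb Z_p$ is the
  closed unit ball, so the sets $p^k O$ form a neighbourhood basis of $0$.\<close>

definition padic_tendsto ::
    "(nat \<Rightarrow> 'p :: prime_card padic_int fract alg_closure) \<Rightarrow> 'p padic_int fract alg_closure \<Rightarrow> bool" where
  "padic_tendsto u L \<longleftrightarrow>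
     (\<forall>k. \<forall>\<^sub>F n in sequentially. \<exists>y\<in>qbar_integers. u n - L = of_nat CARD('p) ^ k * y)"

definition fps_padic_sums ::
    "'p :: prime_card padic_int fps \<Rightarrow> 'p padic_int fract alg_closure \<Rightarrow> 'p padic_int fract alg_closure \<Rightarrow> bool" where
  "fps_padic_sums F x s \<longleftrightarrow> padic_tendsto (\<lambda>n. \<Sum>i<n. to_qbar (fps_nth F i) * x ^ i) s"

definition fps_padic_eval ::
    "'p :: prime_card padic_int fps \<Rightarrow> 'p padic_int fract alg_closure \<Rightarrow> 'p padic_int fract alg_closure" where
  "fps_padic_eval F x = (THE s. fps_padic_sums F x s)"


section \<open>Roots of unity, cyclotomic polynomials, resultants\<close>

definition roots_of_unity :: "nat \<Rightarrow> 'a :: field set" where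
  "roots_of_unity m = {\<zeta>. \<zeta> ^ m = 1}"

definition primitive_root_of_unity :: "nat \<Rightarrow> 'a :: field \<Rightarrow> bool" where
  "primitive_root_of_unity m \<zeta> \<longleftrightarrow> \<zeta> ^ m = 1 \<and> (\<forall>k. 0 < k \<and> k < m \<longrightarrow> \<zeta> ^ k \<noteq> 1)"

definition p_power_roots_of_unity :: "'p :: prime_card padic_int fract alg_closure set" where
  "p_power_roots_of_unity = (\<Union>n. roots_of_unity (CARD('p) ^ n))"

definition cyclotomic :: "nat \<Rightarrow> int poly" where
  "cyclotomic m = (THE f. map_poly of_int f =
     (\<Prod>\<zeta> \<in> {\<zeta> :: complex. primitive_root_of_unity m \<zeta>}. [:- \<zeta>, 1:]))"

text \<open>For monic $f$ the product over the roots in an algebraic closure lies in the base field.\<close>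

definition res_monic :: "'a :: field poly \<Rightarrow> 'a poly \<Rightarrow> 'a" where
  "res_monic f g = of_ac (\<Prod>\<alpha> \<in># proots (map_poly to_ac f). poly (map_poly to_ac g) \<alpha>)"


section \<open>Voltage covers and Grover matrices\<close>

text \<open>In a \<^locale>\<open>bidirected_digraph\<close> the inversion is the identity outside the arcs. The elements
  of the group $\mathbb Z/p^n$ are represented by \<^term>\<open>{0..<int CARD('p) ^ n}\<close>.\<close>

definition layer :: "('v, 'e) pre_digraph \<Rightarrow> ('e \<Rightarrow> 'p :: prime_card padic_int) \<Rightarrow> nat
    \<Rightarrow> ('v \<times> int, 'e \<times> int) pre_digraph" where
  "layer G \<alpha> n = \<lparr>
     verts = verts G \<times> {0..<int CARD('p) ^ n},
     arcs = arcs G \<times> {0..<int CARD('p) ^ n},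
     tail = (\<lambda>(e, g). (tail G e, g)),
     head = (\<lambda>(e, g). (head G e, (g + padic_res (\<alpha> e) n) mod int CARD('p) ^ n))\<rparr>"

definition layer_rev :: "('v, 'e) pre_digraph \<Rightarrow> ('e \<Rightarrow> 'e) \<Rightarrow> ('e \<Rightarrow> 'p :: prime_card padic_int)
    \<Rightarrow> nat \<Rightarrow> 'e \<times> int \<Rightarrow> 'e \<times> int" where
  "layer_rev G \<iota> \<alpha> n = (\<lambda>(e, g). if (e, g) \<in> arcs (layer G \<alpha> n)
     then (\<iota> e, (g + padic_res (\<alpha> e) n) mod int CARD('p) ^ n) else (e, g))"

definition grover_entry :: "('v, 'e) pre_digraph \<Rightarrow> ('e \<Rightarrow> 'e) \<Rightarrow> 'e \<Rightarrow> 'e \<Rightarrow> 'a :: field" where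
  "grover_entry G \<iota> e f =
     (if head G f = tail G e
      then 2 / of_nat (out_degree G (head G f)) - (if f = \<iota> e then 1 else 0)
      else 0)"

text \<open>Library matrices are indexed by natural numbers, so the arcs are listed as \<^term>\<open>es\<close>;
  an eigenvalue is required to be one for every listing (its choice is immaterial).\<close>

definition grover_mat :: "('v, 'e) pre_digraph \<Rightarrow> ('e \<Rightarrow> 'e) \<Rightarrow> 'e list \<Rightarrow> 'a :: field mat" where
  "grover_mat G \<iota> es = mat (length es) (length es) (\<lambda>(i, j). grover_entry G \<iota> (es ! i) (es ! j))"

definition grover_eigenvalue :: "('v, 'e) pre_digraph \<Rightarrow> ('e \<Rightarrow> 'e) \<Rightarrow> 'a :: field \<Rightarrow> bool" where
  "grover_eigenvalue G \<iota> k \<longleftrightarrow>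
     finite (arcs G) \<and> (\<forall>es. distinct es \<and> set es = arcs G \<longrightarrow> eigenvalue (grover_mat G \<iota> es) k)"

lemma layer_bidirected:
  fixes \<alpha> :: "'e \<Rightarrow> 'p :: prime_card padic_int"
  assumes "bidirected_digraph G \<iota>" and "\<And>e. e \<in> arcs G \<Longrightarrow> \<alpha> (\<iota> e) = - \<alpha> e"
  shows "bidirected_digraph (layer G \<alpha> n) (layer_rev G \<iota> \<alpha> n)"
proof -
  interpret G: bidirected_digraph G \<iota> by fact
  have pos: "int CARD('p) ^ n > 0" by simp
  have inv: "((g + padic_res (\<alpha> e) n) mod int CARD('p) ^ n + padic_res (\<alpha> (\<iota> e)) n) mod int CARD('p) ^ n = g"
    if "e \<in> arcs G" "g \<in> {0..<int CARD('p) ^ n}" for e g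
  proof -
    have "((g + padic_res (\<alpha> e) n) mod int CARD('p) ^ n + padic_res (\<alpha> (\<iota> e)) n) mod int CARD('p) ^ n
        = g mod int CARD('p) ^ n"
      using that by (simp add: assms(2) uminus_padic_int.rep_eq mod_simps)
    thus ?thesis using that by simp
  qed
  interpret L: wf_digraph "layer G \<alpha> n"
    by unfold_locales (use pos in \<open>auto simp: layer_def\<close>)
  show ?thesis
    by (rule L.bidirected_digraphI)
       (use pos in \<open>auto simp: layer_def layer_rev_def G.arev_neq inv split: if_splits\<close>)
qed


section \<open>The one-vertex digraph, its spectral polynomial and the test polynomial\<close>

datatype loop = S0 | S1 | S2 | S0_bar | S1_bar | S2_bar

fun loop_rev :: "loop \<Rightarrow> loop" where
  "loop_rev S0 = S0_bar" | "loop_rev S0_bar = S0"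
| "loop_rev S1 = S1_bar" | "loop_rev S1_bar = S1"
| "loop_rev S2 = S2_bar" | "loop_rev S2_bar = S2"

definition X_graph :: "(unit, loop) pre_digraph" where
  "X_graph = \<lparr>verts = UNIV, arcs = UNIV, tail = (\<lambda>_. ()), head = (\<lambda>_. ())\<rparr>"

fun voltage :: "loop \<Rightarrow> Z5" where
  "voltage S0 = 1" | "voltage S0_bar = - 1"
| "voltage S1 = 0" | "voltage S1_bar = 0"
| "voltage S2 = 0" | "voltage S2_bar = 0"

lemma X_bidirected: "bidirected_digraph X_graph loop_rev"
proof -
  interpret wf_digraph X_graph
    by unfold_locales (auto simp: X_graph_def)
  show ?thesis
  proof (rule bidirected_digraphI)
    fix a show "loop_rev a \<noteq> a" "loop_rev (loop_rev a) = a" by (cases a; simp)+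
  qed (auto simp: X_graph_def)
qed

lemma voltage_rev: "voltage (loop_rev e) = - voltage e"
  by (cases e) auto

abbreviation U_eigenvalue :: "nat \<Rightarrow> Q5_bar \<Rightarrow> bool" where
  "U_eigenvalue n \<equiv> grover_eigenvalue (layer X_graph voltage n) (layer_rev X_graph loop_rev voltage n)"

definition z_elem :: "Z5 fps fract" where
  "z_elem = to_fract (1 + fps_X)"

text \<open>The coefficient of $A$ is minus the sum of $w(e) z^{\alpha(e)}$ over the six loops, with
  $w(e) = 1/3$ and $z = 1 + T$; the four loops of voltage $0$ contribute the summand $4$.\<close>

definition spectral_poly_X :: "Z5 fps fract poly" where
  "spectral_poly_X = [:0, 1:] ^ 2 + 1 - smult ((z_elem + inverse z_elem + 4) / 3) [:0, 1:]"

definition R_X :: "Z5 poly \<Rightarrow> Z5 fps fract" where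
  "R_X P = res_monic spectral_poly_X (map_poly (\<lambda>c. to_fract (fps_const c)) P)"

definition P5 :: "Z5 poly" where
  "P5 = [:1, - (7 / 3), 29 / 9, - (7 / 3), 1:]"

end

theory Submission
  imports Defs
begin

text \<open>The polynomial \<open>P\<^sub>5\<close> is palindromic, so \<open>P\<^sub>5(A) = A\<^sup>2 h(A + 1/A)\<close> with
  \<open>h(u) = u\<^sup>2 - 7u/3 + 11/9\<close>. The two roots in \<open>A\<close> of the spectral polynomial have product \<open>1\<close> and sum
  \<open>s = (z + 1/z + 4)/3\<close>, hence the resultant is \<open>h(s)\<^sup>2\<close>, and \<open>h(s) = \<Phi>\<^sub>5(z) / (9z\<^sup>2)\<close>.
  Modulo \<open>5\<close> one has \<open>\<Phi>\<^sub>5(1 + T) = T\<^sup>4\<close>, which gives \<open>\<mu> = 0\<close> and \<open>\<lambda> = 8\<close>. The partial sums at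
  \<open>\<zeta> - 1\<close> converge because \<open>\<zeta> - 1\<close> is topologically nilpotent. The limit is unique because no
  nonzero algebraic element is divisible by every power of \<open>5\<close>; both facts rest on the integral
  closure being a ring with \<open>\<int>\<^sub>5\<close> integrally closed. Finally a root \<open>a\<close> of \<open>P\<^sub>5\<close> determines \<open>z\<close> with
  \<open>z\<^sup>5 = 1\<close> and \<open>a + 1/a = (z + 1/z + 4)/3\<close>, and \<open>(e, g) \<mapsto> z\<^sup>g (a - z\<^bsup>\<alpha>(e)\<^esup>)\<close> is an
  eigenvector of \<open>U\<^sub>n\<close>.\<close>

subsection \<open>Divisibility in the p-adic integers\<close>

lemma padic_int_eqI: "(\<And>n. padic_res x n = padic_res y n) \<Longrightarrow> x = y"
  by (simp add: padic_res_inject[symmetric] fun_eq_iff)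

lemma padic_res_of_nat:
  "padic_res (of_nat k :: 'p :: prime_card padic_int) n = int k mod int CARD('p) ^ n"
  by (induction k) (simp_all add: zero_padic_int.rep_eq one_padic_int.rep_eq plus_padic_int.rep_eq mod_simps)

instance padic_int :: (prime_card) ring_char_0
proof
  show "inj (of_nat :: nat \<Rightarrow> 'a padic_int)"
  proof (rule injI)
    fix a b :: nat
    assume eq: "(of_nat a :: 'a padic_int) = of_nat b"
    have "CARD('a) > 1"
      using prime_card[where 'a = 'a] prime_gt_1_nat by blast
    \<comment> \<open>At level \<open>a + b\<close> both numbers are smaller than the modulus, so
      each equals its own residue.\<close>
    hence "a + b < CARD('a) ^ (a + b)"
      by (simp add: power_gt_expt)
    hence "int a < int CARD('a) ^ (a + b)" "int b < int CARD('a) ^ (a + b)"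
      by (metis add.commute le_add1 le_less_trans of_nat_less_iff of_nat_power)+
    moreover have "int a mod int CARD('a) ^ (a + b) = int b mod int CARD('a) ^ (a + b)"
      using arg_cong[OF eq, of "\<lambda>x. padic_res x (a + b)"] by (simp only: padic_res_of_nat)
    ultimately show "a = b" by simp
  qed
qed

lemma padic_res_0_right [simp]: "padic_res x 0 = 0"
  using padic_res_range[of x 0] by simp

text \<open>The quotient is built level by level: dividing the residue at level \<open>Suc n\<close>
  by p leaves a number determined modulo p^n, so one level is lost.\<close>

lemma padic_prime_dvd_iff:
  fixes x :: "'p :: prime_card padic_int"
  shows "of_nat CARD('p) dvd x \<longleftrightarrow> padic_res x 1 = 0"
proof
  assume "of_nat CARD('p) dvd x"
  thus "padic_res x 1 = 0"
    by (auto simp: times_padic_int.rep_eq padic_res_of_nat)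
next
  assume x: "padic_res x 1 = 0"
  define p where "p = int CARD('p)"
  have p: "p > 0" by (simp add: p_def)
  define y where "y = (\<lambda>n. padic_res x (Suc n) div p)"
  have dvd: "p dvd padic_res x (Suc n)" for n
    using padic_res_add_mod[of x 1 n] x by (simp add: p_def mod_eq_0_iff_dvd)
  have y_range: "y n \<in> {0..<p ^ n}" for n
  proof -
    have r: "padic_res x (Suc n) < p ^ n * p" "0 \<le> padic_res x (Suc n)"
      using padic_res_range[of x "Suc n"] by (auto simp: p_def mult.commute)
    have "p * y n = padic_res x (Suc n)"
      using dvd[of n] by (simp add: y_def)
    with r(1) have "p * y n < p * p ^ n" by (simp add: mult.commute)
    with p have "y n < p ^ n" by simp
    thus ?thesis using r(2) p by (simp add: y_def pos_imp_zdiv_nonneg_iff)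
  qed
  have y_coh: "y (Suc n) mod p ^ n = y n" for n
  proof -
    have "padic_res x (Suc (Suc n)) mod (p * p ^ n) = padic_res x (Suc n)"
      using padic_res_Suc[of x "Suc n"] by (simp add: p_def)
    \<comment> \<open>Splitting off the last digit turns coherence of \<open>x\<close> one level up
      into coherence of \<open>y\<close>; the remainder modulo p vanishes.\<close>
    moreover have "padic_res x (Suc (Suc n)) mod (p * p ^ n) =
        p * (y (Suc n) mod p ^ n) + padic_res x (Suc (Suc n)) mod p"
      unfolding y_def by (rule zmod_zmult2_eq) (use p in simp)
    ultimately have "padic_res x (Suc n) = p * (y (Suc n) mod p ^ n)"
      using dvd[of "Suc n"] by simp
    thus ?thesis using p by (simp add: y_def)
  qed
  define Y :: "'p padic_int" where "Y = Abs_padic_int y"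
  have Y: "padic_res Y = y"
    unfolding Y_def by (rule Abs_padic_int_inverse) (use y_range y_coh in \<open>simp add: p_def\<close>)
  have "x = of_nat CARD('p) * Y"
  proof (rule padic_int_eqI)
    fix n
    have "padic_res (of_nat CARD('p) * Y) n = p * y n mod p ^ n"
      by (simp add: times_padic_int.rep_eq padic_res_of_nat Y mod_simps p_def)
    also have "p * y n = padic_res x (Suc n)"
      using dvd[of n] by (simp add: y_def)
    finally show "padic_res x n = padic_res (of_nat CARD('p) * Y) n"
      by (simp add: p_def padic_res_Suc)
  qed
  thus "of_nat CARD('p) dvd x" by simp
qed

text \<open>A nonzero residue modulo p makes every residue coprime to p^n. Inverses modulo p^n are
  unique, hence coherent, and assemble to an inverse in the limit.\<close>

lemma padic_is_unit_iff:
  fixes x :: "'p :: prime_card padic_int"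
  shows "x dvd 1 \<longleftrightarrow> padic_res x 1 \<noteq> 0"
proof
  assume "x dvd 1"
  then obtain y where y: "1 = x * y" by (elim dvdE)
  have "padic_res (1 :: 'p padic_int) 1 = 1"
    using prime_gt_1_int[OF prime_card_int[where 'a = 'p]] by (simp add: one_padic_int.rep_eq)
  thus "padic_res x 1 \<noteq> 0"
    by (subst (asm) y) (auto simp: times_padic_int.rep_eq)
next
  assume x: "padic_res x 1 \<noteq> 0"
  define p where "p = int CARD('p)"
  have p: "prime p" unfolding p_def by (rule prime_card_int)
  have p0: "p > 0" using p by (simp add: prime_gt_0_int)
  have cop: "coprime (padic_res x n) (p ^ n)" for n
  proof (cases n)
    case (Suc m)
    have "\<not> p dvd padic_res x n"
      using padic_res_add_mod[of x 1 m] x Suc by (simp add: p_def mod_eq_0_iff_dvd[symmetric])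
    hence "coprime p (padic_res x n)"
      using p by (metis prime_imp_coprime)
    thus ?thesis by (simp add: coprime_commute)
  qed auto
  have "\<exists>b. b \<in> {0..<p ^ n} \<and> [padic_res x n * b = 1] (mod p ^ n)" for n
  proof -
    obtain b where "[padic_res x n * b = 1] (mod p ^ n)"
      using cong_solve_coprime_int[OF cop] by blast
    thus ?thesis
      using p0 by (intro exI[of _ "b mod p ^ n"]) (simp add: cong_def mod_simps)
  qed
  then obtain y where y_range: "\<And>n. y n \<in> {0..<p ^ n}"
    and y: "\<And>n. [padic_res x n * y n = 1] (mod p ^ n)"
    by metis
  have y_coh: "y (Suc n) mod p ^ n = y n" for n
  proof -
    have "[padic_res x (Suc n) * y (Suc n) = 1] (mod p ^ n)"
      using y[of "Suc n"] by (rule cong_dvd_modulus) simp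
    moreover have "[padic_res x (Suc n) = padic_res x n] (mod p ^ n)"
      by (simp add: cong_def p_def padic_res_Suc)
    ultimately have "[padic_res x n * y (Suc n) = padic_res x n * y n] (mod p ^ n)"
      using y[of n] by (metis cong_scalar_right cong_sym cong_trans)
    hence "[y (Suc n) = y n] (mod p ^ n)"
      using cop cong_mult_lcancel by blast
    thus ?thesis using y_range[of n] by (simp add: cong_def)
  qed
  define Y :: "'p padic_int" where "Y = Abs_padic_int y"
  have Y: "padic_res Y = y"
    unfolding Y_def by (rule Abs_padic_int_inverse) (use y_range y_coh in \<open>simp add: p_def\<close>)
  have "1 = x * Y"
    using y by (intro padic_int_eqI) (simp add: times_padic_int.rep_eq one_padic_int.rep_eq Y cong_def p_def)
  thus "x dvd 1" by (rule dvdI)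
qed

text \<open>Factors p are split off by induction on a level at which the residue is nonzero: each
  division by p lowers that level by one, so the process stops.\<close>

lemma padic_int_valuation:
  fixes x :: "'p :: prime_card padic_int"
  assumes "x \<noteq> 0"
  obtains v u where "x = of_nat CARD('p) ^ v * u" "padic_res u 1 \<noteq> 0"
proof -
  have "\<exists>v u. x = of_nat CARD('p) ^ v * u \<and> padic_res u 1 \<noteq> 0" if "padic_res x n \<noteq> 0" for n
    using that
  proof (induction n arbitrary: x)
    case (Suc n)
    show ?case
    proof (cases "padic_res x 1 = 0")
      case True
      then obtain y where y: "x = of_nat CARD('p) * y"
        using padic_prime_dvd_iff[of x] by blast
      have "padic_res y n \<noteq> 0"
      proof
        assume "padic_res y n = 0"
        hence "int CARD('p) ^ n dvd padic_res y (Suc n)"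
          using padic_res_eq_0_iff[of y n 1] by simp
        hence "int CARD('p) ^ Suc n dvd int CARD('p) * padic_res y (Suc n)"
          by simp
        hence "padic_res x (Suc n) = 0"
          by (simp add: y times_padic_int.rep_eq padic_res_of_nat mod_simps)
        with Suc.prems show False by simp
      qed
      then obtain v u where "y = of_nat CARD('p) ^ v * u" "padic_res u 1 \<noteq> 0"
        using Suc.IH by blast
      thus ?thesis
        by (intro exI[of _ "Suc v"] exI[of _ u]) (simp add: y mult.assoc)
    next
      case False
      thus ?thesis by (intro exI[of _ 0] exI[of _ x]) simp
    qed
  qed simp
  moreover obtain n where "padic_res x n \<noteq> 0"
    using assms padic_int_eqI[of x 0] by (auto simp: zero_padic_int.rep_eq)
  ultimately show ?thesis using that by blast
qed

section \<open>Numerals, characteristic zero and division by units under homomorphisms\<close>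

lemma to_fract_of_nat [simp]: "to_fract (of_nat n) = of_nat n"
  by (induction n) simp_all

lemma to_fract_numeral [simp]: "to_fract (numeral n) = numeral n"
  using to_fract_of_nat[of "numeral n"] by (simp del: to_fract_of_nat)

lemma to_fract_power [simp]: "to_fract (x ^ n) = to_fract x ^ n"
  by (induction n) simp_all

instance fps :: (ring_char_0) ring_char_0 ..

instance fract :: ("{idom, ring_char_0}") field_char_0
proof
  show "inj (of_nat :: nat \<Rightarrow> 'a fract)"
    by (metis (mono_tags, lifting) injI of_nat_eq_iff to_fract_eq_iff to_fract_of_nat)
qed

lemma padic_res_numeral:
  "padic_res (numeral k :: 'p :: prime_card padic_int) n = numeral k mod int CARD('p) ^ n"
  using padic_res_of_nat[of "numeral k" n, where 'p = 'p] by simp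

text \<open>Division in Z_p is genuine only by units and otherwise defaults to 0. For a unit
  denominator, multiplicativity of \<open>h\<close> is enough to carry a fraction such as 7/3 into a
  field.\<close>

lemma padic_hom_divide:
  fixes x u :: "'p :: prime_card padic_int" and h :: "'p padic_int \<Rightarrow> 'a :: field"
  assumes u: "padic_res u 1 \<noteq> 0" and h: "\<And>x y. h (x * y) = h x * h y" "h u \<noteq> 0"
  shows "h (x / u) = h x / h u"
proof -
  have "u * inverse u = 1"
    using u padic_unit_inverse[of u] padic_is_unit_iff[of u] by simp
  hence "x = x / u * u"
    by (simp add: divide_padic_int_def mult.assoc mult.commute)
  hence "h x = h (x / u) * h u"
    by (metis h(1))
  thus ?thesis using h(2) by simp
qed

subsection \<open>The ring of integers of the algebraic closure\<close>

lemma comm_ring_hom_to_qbar: "comm_ring_hom to_qbar"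
  by unfold_locales simp_all

lemma to_qbar_sum: "to_qbar (sum f A) = (\<Sum>i\<in>A. to_qbar (f i))"
  by (simp add: to_ac_sum)

text \<open>A finitely generated Z_p-module inside the algebraic closure. Integrality proofs go
  through modules of this kind, without exhibiting monic polynomials.\<close>

definition qbar_span :: "('i \<Rightarrow> 'p :: prime_card padic_int fract alg_closure) \<Rightarrow> 'i set
    \<Rightarrow> 'p padic_int fract alg_closure set" where
  "qbar_span v I = range (\<lambda>c. \<Sum>i\<in>I. to_qbar (c i) * v i)"

lemma qbar_spanI: "s = (\<Sum>i\<in>I. to_qbar (c i) * v i) \<Longrightarrow> s \<in> qbar_span v I"
  by (auto simp: qbar_span_def)

lemma qbar_spanE:
  assumes "s \<in> qbar_span v I"
  obtains c where "s = (\<Sum>i\<in>I. to_qbar (c i) * v i)"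
  using assms by (auto simp: qbar_span_def)

lemma qbar_span_scale:
  assumes "s \<in> qbar_span v I"
  shows "to_qbar a * s \<in> qbar_span v I"
proof -
  obtain c where "s = (\<Sum>i\<in>I. to_qbar (c i) * v i)" using assms by (rule qbar_spanE)
  thus ?thesis
    by (intro qbar_spanI[where c = "\<lambda>i. a * c i"]) (simp add: sum_distrib_left mult.assoc)
qed

lemma qbar_span_base:
  assumes "finite I" "i \<in> I"
  shows "v i \<in> qbar_span v I"
proof (rule qbar_spanI)
  have "(\<Sum>j\<in>I. to_qbar (if j = i then 1 else 0) * v j) = (\<Sum>j\<in>I. if j = i then v i else 0)"
    by (intro sum.cong) auto
  thus "v i = (\<Sum>j\<in>I. to_qbar (if j = i then 1 else 0) * v j)"
    using assms by simp
qed

lemma qbar_span_add: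
  assumes "s \<in> qbar_span v I" "t \<in> qbar_span v I"
  shows "s + t \<in> qbar_span v I"
proof -
  obtain c where c: "s = (\<Sum>i\<in>I. to_qbar (c i) * v i)" using assms(1) by (rule qbar_spanE)
  obtain d where d: "t = (\<Sum>i\<in>I. to_qbar (d i) * v i)" using assms(2) by (rule qbar_spanE)
  show ?thesis
    by (rule qbar_spanI[where c = "\<lambda>i. c i + d i"])
       (simp add: c d sum.distrib distrib_right)
qed

lemma qbar_span_sum:
  assumes "\<And>k. k \<in> K \<Longrightarrow> t k \<in> qbar_span v I"
  shows "sum t K \<in> qbar_span v I"
  using assms
proof (induction K rule: infinite_finite_induct)
  case (insert k K)
  thus ?case by (simp add: qbar_span_add)
qed (auto intro: qbar_spanI[where c = "\<lambda>_. 0"])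

lemma qbar_span_mult_closed:
  assumes "\<And>i. i \<in> I \<Longrightarrow> x * v i \<in> qbar_span v I" "s \<in> qbar_span v I"
  shows "x * s \<in> qbar_span v I"
proof -
  obtain c where "s = (\<Sum>i\<in>I. to_qbar (c i) * v i)" using assms(2) by (rule qbar_spanE)
  hence "x * s = (\<Sum>i\<in>I. to_qbar (c i) * (x * v i))"
    by (simp add: sum_distrib_left mult.left_commute)
  thus ?thesis using assms(1) by (simp add: qbar_span_sum qbar_span_scale)
qed

text \<open>An element that stabilises a nonzero finitely generated module is an eigenvalue of a matrix
  over the base ring, hence a root of its characteristic polynomial.\<close>

lemma qbar_integersI_span:
  assumes fin: "finite I" and k: "k \<in> I" "v k \<noteq> 0"
    and stable: "\<And>i. i \<in> I \<Longrightarrow> x * v i \<in> qbar_span v I"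
  shows "x \<in> qbar_integers"
proof -
  define n where "n = card I"
  obtain h where h: "bij_betw h {..<n} I"
    using ex_bij_betw_nat_finite[OF fin] by (auto simp: n_def atLeast0LessThan)
  have hI: "h i \<in> I" if "i < n" for i
    using h that by (auto simp: bij_betw_def)
  have "\<forall>i\<in>I. \<exists>c. x * v i = (\<Sum>j\<in>I. to_qbar (c j) * v j)"
    using stable by (auto elim!: qbar_spanE)
  then obtain C where C: "\<And>i. i \<in> I \<Longrightarrow> x * v i = (\<Sum>j\<in>I. to_qbar (C i j) * v j)"
    by metis
  define M where "M = mat n n (\<lambda>(i, j). C (h i) (h j))"
  define w where "w = vec n (\<lambda>i. v (h i))"
  interpret hom: comm_ring_hom to_qbar
    by (rule comm_ring_hom_to_qbar)
  have M: "M \<in> carrier_mat n n" by (simp add: M_def)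
  have "map_mat to_qbar M *\<^sub>v w = x \<cdot>\<^sub>v w"
  proof (rule eq_vecI)
    fix i assume "i < dim_vec (x \<cdot>\<^sub>v w)"
    hence i: "i < n" by (simp add: w_def)
    have "(map_mat to_qbar M *\<^sub>v w) $ i = (\<Sum>j<n. to_qbar (C (h i) (h j)) * v (h j))"
      using i by (simp add: M_def w_def scalar_prod_def atLeast0LessThan)
    also have "\<dots> = (\<Sum>j\<in>I. to_qbar (C (h i) j) * v j)"
      by (rule sum.reindex_bij_betw[OF h])
    also have "\<dots> = x * v (h i)"
      using C[OF hI[OF i]] by simp
    finally show "(map_mat to_qbar M *\<^sub>v w) $ i = (x \<cdot>\<^sub>v w) $ i"
      using i by (simp add: w_def)
  qed (simp add: M_def w_def)
  moreover have "w \<noteq> 0\<^sub>v n"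
  proof
    assume w0: "w = 0\<^sub>v n"
    obtain i where "i < n" "h i = k"
      using h k by (auto simp: bij_betw_def)
    hence "w $ i = v k" by (simp add: w_def)
    with w0 \<open>i < n\<close> k show False by simp
  qed
  ultimately have "eigenvalue (map_mat to_qbar M) x"
    unfolding eigenvalue_def eigenvector_def using M
    by (intro exI[of _ w]) (simp add: w_def)
  hence "poly (map_poly to_qbar (char_poly M)) x = 0"
    using M by (simp add: eigenvalue_root_char_poly[of _ n] hom.char_poly_hom)
  moreover have "lead_coeff (char_poly M) = 1"
    using degree_monic_char_poly[OF M] by simp
  ultimately show ?thesis
    unfolding qbar_integers_def by blast
qed

lemma poly_to_qbar_altdef:
  "poly (map_poly to_qbar f) x = (\<Sum>i\<le>degree f. to_qbar (coeff f i) * x ^ i)"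
  by (simp add: poly_altdef degree_map_poly coeff_map_poly)

lemma qbar_integersE:
  assumes "x \<in> qbar_integers"
  obtains n c where "n > 0" "x ^ n = (\<Sum>k<n. to_qbar (c k) * x ^ k)"
proof -
  obtain f where f: "lead_coeff f = 1" "poly (map_poly to_qbar f) x = 0"
    using assms by (auto simp: qbar_integers_def)
  have eq: "(\<Sum>k<degree f. to_qbar (coeff f k) * x ^ k) + x ^ degree f = 0"
    using f by (simp add: poly_to_qbar_altdef lessThan_Suc_atMost[symmetric])
  hence "degree f > 0"
    by (intro Nat.gr0I) auto
  moreover have "x ^ degree f = (\<Sum>k<degree f. to_qbar (- coeff f k) * x ^ k)"
    using eq by (simp add: sum_negf eq_neg_iff_add_eq_0 add.commute)
  ultimately show ?thesis by (rule that)
qed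

text \<open>The monomials x^i y^j below the degrees of the two monic equations span a module stable
  under \<open>x\<close> and \<open>y\<close>, hence under their sum and product.\<close>

lemma
  assumes "x \<in> qbar_integers" "y \<in> qbar_integers"
  shows qbar_integers_add: "x + y \<in> qbar_integers"
    and qbar_integers_mult: "x * y \<in> qbar_integers"
proof -
  obtain n c where n: "n > 0" and c: "x ^ n = (\<Sum>k<n. to_qbar (c k) * x ^ k)"
    using assms(1) by (rule qbar_integersE)
  obtain m d where m: "m > 0" and d: "y ^ m = (\<Sum>k<m. to_qbar (d k) * y ^ k)"
    using assms(2) by (rule qbar_integersE)
  define I where "I = {..<n} \<times> {..<m}"
  define v where "v = (\<lambda>(i, j). x ^ i * y ^ j)"
  have fin: "finite I" by (simp add: I_def)
  have x: "x * v ij \<in> qbar_span v I" if ij_I: "ij \<in> I" for ij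
  proof -
    obtain i j where ij: "ij = (i, j)" by (cases ij)
    show ?thesis
    proof (cases "Suc i = n")
      \<comment> \<open>At the upper boundary the monic equation of \<open>x\<close> rewrites x^n in
        lower powers.\<close>
      case True
      have "x * v ij = x ^ n * y ^ j"
        by (simp add: ij v_def True[symmetric] mult.assoc)
      also have "\<dots> = (\<Sum>k<n. to_qbar (c k) * v (k, j))"
        by (simp add: c sum_distrib_right v_def mult.assoc)
      also have "\<dots> \<in> qbar_span v I"
        using ij_I by (intro qbar_span_sum qbar_span_scale qbar_span_base[OF fin]) (auto simp: ij I_def)
      finally show ?thesis .
    next
      case False
      have "x * v ij = v (Suc i, j)"
        by (simp add: ij v_def mult.assoc)
      thus ?thesis
        using ij_I False qbar_span_base[OF fin, of "(Suc i, j)" v] by (auto simp: ij I_def)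
    qed
  qed
  have y: "y * v ij \<in> qbar_span v I" if ij_I: "ij \<in> I" for ij
  proof -
    obtain i j where ij: "ij = (i, j)" by (cases ij)
    show ?thesis
    proof (cases "Suc j = m")
      case True
      have "y * v ij = x ^ i * y ^ m"
        by (simp add: ij v_def True[symmetric] mult.left_commute)
      also have "\<dots> = (\<Sum>k<m. to_qbar (d k) * v (i, k))"
        by (simp add: d sum_distrib_left v_def mult.left_commute)
      also have "\<dots> \<in> qbar_span v I"
        using ij_I by (intro qbar_span_sum qbar_span_scale qbar_span_base[OF fin]) (auto simp: ij I_def)
      finally show ?thesis .
    next
      case False
      have "y * v ij = v (i, Suc j)"
        by (simp add: ij v_def mult.left_commute)
      thus ?thesis
        using ij_I False qbar_span_base[OF fin, of "(i, Suc j)" v] by (auto simp: ij I_def)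
    qed
  qed
  have I0: "(0, 0) \<in> I" "v (0, 0) \<noteq> 0"
    using n m by (simp_all add: I_def v_def)
  show "x + y \<in> qbar_integers"
    by (rule qbar_integersI_span[where k = "(0, 0)" and v = v, OF fin I0])
       (simp add: distrib_right qbar_span_add x y)
  show "x * y \<in> qbar_integers"
    by (rule qbar_integersI_span[where k = "(0, 0)" and v = v, OF fin I0])
       (simp add: mult.assoc, blast intro: qbar_span_mult_closed x y)
qed

lemma to_qbar_in_integers: "to_qbar c \<in> qbar_integers"
  unfolding qbar_integers_def
  by (rule CollectI, rule exI[of _ "[:- c, 1:]"]) (simp add: map_poly_pCons)

lemma of_nat_in_qbar_integers: "of_nat n \<in> qbar_integers"
  using to_qbar_in_integers[of "of_nat n"] by simp

lemma one_in_qbar_integers: "1 \<in> qbar_integers"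
  using of_nat_in_qbar_integers[of 1] by simp

lemma qbar_integers_uminus: "x \<in> qbar_integers \<Longrightarrow> - x \<in> qbar_integers"
  using qbar_integers_mult[OF to_qbar_in_integers[of "- 1"], of x] by simp

lemma qbar_integers_diff: "x \<in> qbar_integers \<Longrightarrow> y \<in> qbar_integers \<Longrightarrow> x - y \<in> qbar_integers"
  using qbar_integers_add[OF _ qbar_integers_uminus, of x y] by simp

lemma qbar_integers_power: "x \<in> qbar_integers \<Longrightarrow> x ^ n \<in> qbar_integers"
  by (induction n) (simp_all add: one_in_qbar_integers qbar_integers_mult)

lemma qbar_integers_sum:
  assumes "\<And>k. k \<in> K \<Longrightarrow> t k \<in> qbar_integers"
  shows "sum t K \<in> qbar_integers"
  using assms
proof (induction K rule: infinite_finite_induct)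
  case (insert k K)
  thus ?case by (simp add: qbar_integers_add)
qed (use of_nat_in_qbar_integers[of 0] in auto)

lemma qbar_integers_poly:
  "x \<in> qbar_integers \<Longrightarrow> poly (map_poly to_qbar f) x \<in> qbar_integers"
  unfolding poly_to_qbar_altdef
  by (intro qbar_integers_sum qbar_integers_mult to_qbar_in_integers qbar_integers_power)

text \<open>Multiplication by zeta permutes the powers of zeta cyclically, so their span is
  stable.\<close>

lemma root_of_unity_in_qbar_integers:
  assumes "\<zeta> ^ n = 1" "n > 0"
  shows "\<zeta> \<in> qbar_integers"
proof (rule qbar_integersI_span[of "{..<n}" 0 "\<lambda>i. \<zeta> ^ i"])
  fix i assume i: "i \<in> {..<n}"
  have "\<zeta> * \<zeta> ^ i = \<zeta> ^ (Suc i mod n)"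
  proof (cases "Suc i = n")
    case True
    thus ?thesis using assms(1) by (metis mod_self power_0 power_Suc)
  qed (use i in auto)
  moreover have "Suc i mod n \<in> {..<n}" using assms(2) by simp
  ultimately show "\<zeta> * \<zeta> ^ i \<in> qbar_span (\<lambda>i. \<zeta> ^ i) {..<n}"
    using qbar_span_base[of "{..<n}" "Suc i mod n" "\<lambda>i. \<zeta> ^ i"] by simp
qed (use assms in auto)

section \<open>Denominators of algebraic elements and separation by powers of p\<close>

lemma fract_poly_clear_denominators:
  fixes f :: "'a :: idom fract poly"
  obtains c q where "c \<noteq> 0" "smult (to_fract c) f = map_poly to_fract q"
proof -
  have "\<exists>c q. c \<noteq> 0 \<and> smult (to_fract c) f = map_poly to_fract q"
  proof (induction f)
    case 0
    show ?case by (intro exI[of _ 1] exI[of _ 0]) simp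
  next
    case (pCons a f)
    then obtain c q where cq: "c \<noteq> 0" "smult (to_fract c) f = map_poly to_fract q" by blast
    obtain u w where uw: "a = to_fract u / to_fract w" "w \<noteq> 0"
      by (cases a) (auto simp: Fract_conv_to_fract)
    have "smult (to_fract (w * c)) (pCons a f) = map_poly to_fract (pCons (c * u) (smult w q))"
    proof (rule poly_eqI)
      fix n
      have "to_fract c * coeff f k = to_fract (coeff q k)" for k
        using arg_cong[OF cq(2), of "\<lambda>p. coeff p k"] by (simp add: coeff_map_poly)
      thus "coeff (smult (to_fract (w * c)) (pCons a f)) n =
          coeff (map_poly to_fract (pCons (c * u) (smult w q))) n"
        using uw by (cases n) (simp_all add: coeff_map_poly mult.assoc)
    qed
    thus ?case using cq uw by (intro exI[of _ "w * c"] exI) auto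
  qed
  thus ?thesis using that by blast
qed

text \<open>If l is the leading coefficient of an equation for \<open>x\<close> of degree n with
  coefficients in Z_p, then l x^n lies in the span of the lower powers of \<open>x\<close>. So l x
  stabilises that span.\<close>

lemma qbar_integral_multiple:
  fixes x :: "'p :: prime_card padic_int fract alg_closure"
  obtains c where "c \<noteq> 0" "to_qbar c * x \<in> qbar_integers"
proof -
  obtain f where f: "f \<noteq> 0" "poly (map_poly to_ac f) x = 0"
    by (rule alg_closure_algebraic)
  obtain b q where bq: "b \<noteq> 0" "smult (to_fract b) f = map_poly to_fract q"
    by (rule fract_poly_clear_denominators)
  have "q \<noteq> 0"
    using f bq by auto
  have "map_poly to_qbar q = map_poly to_ac (map_poly to_fract q)"
    by (simp add: map_poly_map_poly o_def)
  also have "\<dots> = smult (to_qbar b) (map_poly to_ac f)"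
    by (simp add: bq(2)[symmetric] map_poly_smult)
  finally have root: "poly (map_poly to_qbar q) x = 0"
    using f by simp
  define n where "n = degree q"
  have eq: "(\<Sum>k<n. to_qbar (coeff q k) * x ^ k) + to_qbar (lead_coeff q) * x ^ n = 0"
    using root by (simp add: poly_to_qbar_altdef lessThan_Suc_atMost[symmetric] n_def)
  have n: "n > 0"
  proof (rule Nat.gr0I)
    assume "n = 0"
    with eq have "lead_coeff q = 0" by simp
    thus False using \<open>q \<noteq> 0\<close> by (simp only: leading_coeff_0_iff)
  qed
  have "to_qbar (lead_coeff q) * x \<in> qbar_integers"
  proof (rule qbar_integersI_span[of "{..<n}" 0 "\<lambda>i. x ^ i"])
    fix i assume i: "i \<in> {..<n}"
    show "to_qbar (lead_coeff q) * x * x ^ i \<in> qbar_span (\<lambda>i. x ^ i) {..<n}"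
    proof (cases "Suc i = n")
      case True
      hence "to_qbar (lead_coeff q) * x * x ^ i = to_qbar (lead_coeff q) * x ^ n"
        by (auto simp: mult.assoc)
      also have "\<dots> = (\<Sum>k<n. to_qbar (- coeff q k) * x ^ k)"
        using eq by (simp add: sum_negf eq_neg_iff_add_eq_0 add.commute)
      also have "\<dots> \<in> qbar_span (\<lambda>i. x ^ i) {..<n}"
        by (rule qbar_spanI) (rule refl)
      finally show ?thesis .
    next
      case False
      hence "x ^ Suc i \<in> qbar_span (\<lambda>i. x ^ i) {..<n}"
        using i by (intro qbar_span_base) auto
      thus ?thesis using qbar_span_scale[of "x ^ Suc i"] by (simp add: mult.assoc)
    qed
  qed (use n in auto)
  thus ?thesis using \<open>q \<noteq> 0\<close> by (intro that) auto
qed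

text \<open>If \<open>u / p = w\<close> were integral, clearing denominators in its monic equation would make
  \<open>p\<close> divide a power of \<open>u\<close>.\<close>

lemma unit_div_prime_not_integral:
  fixes u :: "'p :: prime_card padic_int"
  assumes u: "padic_res u 1 \<noteq> 0"
  assumes w: "w \<in> qbar_integers" "to_qbar u = of_nat CARD('p) * w"
  shows False
proof -
  define p where "p = (of_nat CARD('p) :: 'p padic_int)"
  obtain n c where n: "n > 0" and c: "w ^ n = (\<Sum>k<n. to_qbar (c k) * w ^ k)"
    using w(1) by (rule qbar_integersE)
  have uw: "to_qbar u = to_qbar p * w"
    using w(2) by (simp add: p_def)
  have "to_qbar (u ^ n) = to_qbar p ^ n * w ^ n"
    using uw by (simp add: power_mult_distrib)
  also have "\<dots> = (\<Sum>k<n. to_qbar (c k) * (to_qbar p ^ n * w ^ k))"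
    by (simp add: c sum_distrib_left mult.left_commute)
  also have "\<dots> = (\<Sum>k<n. to_qbar (p * (c k * p ^ (n - Suc k) * u ^ k)))"
  proof (intro sum.cong refl)
    fix k assume "k \<in> {..<n}"
    hence "n = Suc (n - Suc k) + k" by simp
    hence "to_qbar p ^ n = to_qbar p * to_qbar p ^ (n - Suc k) * to_qbar p ^ k"
      by (metis power_Suc power_add)
    thus "to_qbar (c k) * (to_qbar p ^ n * w ^ k) = to_qbar (p * (c k * p ^ (n - Suc k) * u ^ k))"
      using uw by (simp add: power_mult_distrib mult_ac)
  qed
  also have "\<dots> = to_qbar (p * (\<Sum>k<n. c k * p ^ (n - Suc k) * u ^ k))"
    by (simp only: to_qbar_sum sum_distrib_left)
  finally have "u ^ n = p * (\<Sum>k<n. c k * p ^ (n - Suc k) * u ^ k)"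
    by (simp only: to_ac_eq_iff to_fract_eq_iff)
  hence "p dvd u ^ n" by (rule dvdI)
  moreover have "u ^ n dvd 1"
    using u padic_is_unit_iff[of u] dvd_power_same[of u 1 n] by simp
  ultimately have "p dvd 1" by (rule dvd_trans)
  thus False
    using padic_is_unit_iff[of p] by (simp add: p_def padic_res_of_nat)
qed

text \<open>For nonzero \<open>d\<close> some c/d with c nonzero is integral. If \<open>d\<close>
  were divisible by a higher power of p than c is, a unit divided by p would be integral.\<close>

lemma infinitely_divisible_imp_0:
  fixes d :: "'p :: prime_card padic_int fract alg_closure"
  assumes "\<And>k. \<exists>y\<in>qbar_integers. d = of_nat CARD('p) ^ k * y"
  shows "d = 0"
proof (rule ccontr)
  assume d: "d \<noteq> 0"
  obtain c where c: "c \<noteq> 0" "to_qbar c * inverse d \<in> qbar_integers"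
    by (rule qbar_integral_multiple)
  obtain v u where vu: "c = of_nat CARD('p) ^ v * u" "padic_res u 1 \<noteq> 0"
    using c(1) by (rule padic_int_valuation)
  \<comment> \<open>The exponent is one more than the valuation of \<open>c\<close>, which leaves
    exactly one factor p beside the unit \<open>u\<close>.\<close>
  obtain y where y: "y \<in> qbar_integers" "d = of_nat CARD('p) ^ Suc v * y"
    using assms by blast
  have "to_qbar u = of_nat CARD('p) * (to_qbar c * inverse d * y)"
    using d by (simp add: y(2) vu(1) field_simps)
  thus False
    using unit_div_prime_not_integral[OF vu(2)] c(2) y(1) qbar_integers_mult by blast
qed

lemma padic_tendsto_unique:
  fixes L L' :: "'p :: prime_card padic_int fract alg_closure"
  assumes "padic_tendsto u L" "padic_tendsto u L'"
  shows "L = L'"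
proof -
  have "L - L' = 0"
  proof (rule infinitely_divisible_imp_0)
    fix k
    have "\<forall>\<^sub>F n in sequentially. (\<exists>y\<in>qbar_integers. u n - L = of_nat CARD('p) ^ k * y) \<and>
        (\<exists>y\<in>qbar_integers. u n - L' = of_nat CARD('p) ^ k * y)"
      using assms by (intro eventually_conj) (auto simp: padic_tendsto_def)
    then obtain n y y' where y: "y \<in> qbar_integers" "u n - L = of_nat CARD('p) ^ k * y"
      and y': "y' \<in> qbar_integers" "u n - L' = of_nat CARD('p) ^ k * y'"
      using eventually_happens'[OF sequentially_bot] by blast
    have "L - L' = (u n - L') - (u n - L)" by simp
    also have "\<dots> = of_nat CARD('p) ^ k * (y' - y)"
      by (simp only: y y' right_diff_distrib)
    finally show "\<exists>y\<in>qbar_integers. L - L' = of_nat CARD('p) ^ k * y"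
      using y y' qbar_integers_diff by blast
  qed
  thus ?thesis by simp
qed

subsection \<open>Evaluation of rational power series\<close>

text \<open>A truncation \<open>T\<close> of F = N/Q satisfies QT = N up to a multiple of X^n. At
  \<open>x\<close> the error is therefore x^n times an integral element, and it tends to 0 because
  some power of \<open>x\<close> is divisible by p.\<close>

lemma fps_padic_sums_rational:
  fixes F :: "'p :: prime_card padic_int fps"
  assumes F: "fps_of_poly Q * F = fps_of_poly N"
    and x: "x \<in> qbar_integers" "x ^ r = of_nat CARD('p) * y" "y \<in> qbar_integers"
    and Q: "poly (map_poly to_qbar Q) x \<noteq> 0" "inverse (poly (map_poly to_qbar Q) x) \<in> qbar_integers"
  shows "fps_padic_sums F x (poly (map_poly to_qbar N) x / poly (map_poly to_qbar Q) x)"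
  unfolding fps_padic_sums_def padic_tendsto_def
proof
  fix k
  interpret hom: comm_ring_hom to_qbar
    by (rule comm_ring_hom_to_qbar)
  interpret P: map_poly_comm_ring_hom to_qbar ..
  define ev where "ev = (\<lambda>f. poly (map_poly to_qbar f) x)"
  show "\<forall>\<^sub>F n in sequentially. \<exists>y\<in>qbar_integers.
      (\<Sum>i<n. to_qbar (fps_nth F i) * x ^ i) -
        poly (map_poly to_qbar N) x / poly (map_poly to_qbar Q) x = of_nat CARD('p) ^ k * y"
  \<comment> \<open>From n = r k on, x^n contains k factors x^r, each contributing one factor
    p.\<close>
  proof (rule eventually_sequentiallyI[of "r * k"])
    fix n assume n: "r * k \<le> n"
    define T where "T = (\<Sum>i<n. monom (fps_nth F i) i)"
    have coeff_T: "coeff T i = fps_nth F i" if "i < n" for i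
    proof -
      have "coeff T i = (\<Sum>j<n. if i = j then fps_nth F j else 0)"
        unfolding T_def coeff_sum by (intro sum.cong) auto
      thus ?thesis using that by simp
    qed
    have T: "ev T = (\<Sum>i<n. to_qbar (fps_nth F i) * x ^ i)"
      by (simp add: T_def ev_def P.hom_sum map_poly_monom poly_sum poly_monom)
    have "monom 1 n dvd Q * T - N"
      unfolding monom_1_dvd_iff'
    proof (intro allI impI)
      fix i assume i: "i < n"
      have "coeff (Q * T) i = (\<Sum>j\<le>i. coeff Q j * fps_nth F (i - j))"
        unfolding coeff_mult using i by (intro sum.cong) (auto simp: coeff_T)
      also have "\<dots> = fps_nth (fps_of_poly Q * F) i"
        by (simp add: fps_mult_nth atLeast0AtMost)
      finally show "coeff (Q * T - N) i = 0"
        by (simp add: F)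
    qed
    then obtain R where R: "Q * T - N = monom 1 n * R" by (elim dvdE)
    have evQ: "ev Q \<noteq> 0"
      using Q(1) by (simp add: ev_def)
    have "ev Q * ev T - ev N = ev (Q * T - N)"
      by (simp add: ev_def P.hom_minus P.hom_mult)
    also have "\<dots> = x ^ n * ev R"
      by (simp add: R ev_def P.hom_mult map_poly_monom poly_monom)
    also have "x ^ n = (x ^ r) ^ k * x ^ (n - r * k)"
      using n by (simp add: power_mult[symmetric] power_add[symmetric])
    finally have "ev T - ev N / ev Q
        = of_nat CARD('p) ^ k * (y ^ k * x ^ (n - r * k) * ev R * inverse (ev Q))"
      using evQ by (simp add: x(2) power_mult_distrib field_simps)
    moreover have "y ^ k * x ^ (n - r * k) * ev R * inverse (ev Q) \<in> qbar_integers"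
      using x Q by (intro qbar_integers_mult qbar_integers_power) (auto simp: ev_def qbar_integers_poly)
    ultimately have "\<exists>y\<in>qbar_integers. ev T - ev N / ev Q = of_nat CARD('p) ^ k * y"
      by blast
    thus "\<exists>y\<in>qbar_integers.
      (\<Sum>i<n. to_qbar (fps_nth F i) * x ^ i) -
        poly (map_poly to_qbar N) x / poly (map_poly to_qbar Q) x = of_nat CARD('p) ^ k * y"
      unfolding T unfolding ev_def .
  qed
qed

lemma fps_padic_sums_unique: "fps_padic_sums F x s \<Longrightarrow> fps_padic_sums F x s' \<Longrightarrow> s = s'"
  unfolding fps_padic_sums_def by (rule padic_tendsto_unique)

section \<open>Frobenius congruences modulo p\<close>

lemma qbar_freshmans_dream:
  fixes a b :: "'p :: prime_card padic_int fract alg_closure"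
  assumes "a \<in> qbar_integers" "b \<in> qbar_integers"
  shows "\<exists>y\<in>qbar_integers. (a + b) ^ CARD('p) = a ^ CARD('p) + b ^ CARD('p) + of_nat CARD('p) * y"
proof -
  define p where "p = CARD('p)"
  have p: "prime p" unfolding p_def by (rule prime_card)
  have "{..p} = insert 0 (insert p {0<..<p})"
    using prime_gt_0_nat[OF p] by auto
  hence "(a + b) ^ p = a ^ p + b ^ p + (\<Sum>k\<in>{0<..<p}. of_nat (p choose k) * a ^ k * b ^ (p - k))"
    using prime_gt_0_nat[OF p] by (simp add: binomial_ring)
  also have "(\<Sum>k\<in>{0<..<p}. of_nat (p choose k) * a ^ k * b ^ (p - k))
      = of_nat p * (\<Sum>k\<in>{0<..<p}. of_nat ((p choose k) div p) * a ^ k * b ^ (p - k))"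
    unfolding sum_distrib_left
  proof (intro sum.cong refl)
    fix k assume k: "k \<in> {0<..<p}"
    hence "p dvd p choose k"
      using p by (intro dvd_choose_prime) auto
    hence "p choose k = p * ((p choose k) div p)" by simp
    hence "(of_nat (p choose k) :: 'p padic_int fract alg_closure) = of_nat p * of_nat ((p choose k) div p)"
      by (metis of_nat_mult)
    thus "of_nat (p choose k) * a ^ k * b ^ (p - k)
        = of_nat p * (of_nat ((p choose k) div p) * a ^ k * b ^ (p - k))"
      by (simp add: mult.assoc)
  qed
  finally show ?thesis
    unfolding p_def[symmetric]
    by (rule bexI) (intro qbar_integers_sum qbar_integers_mult of_nat_in_qbar_integers qbar_integers_power assms)
qed

text \<open>Applied to zeta and -1, this is what makes zeta - 1 topologically nilpotent for zeta of
  p-power order.\<close>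

lemma qbar_frobenius_power:
  fixes a b :: "'p :: prime_card padic_int fract alg_closure"
  assumes "a \<in> qbar_integers" "b \<in> qbar_integers"
  shows "\<exists>y\<in>qbar_integers. (a + b) ^ (CARD('p) ^ m)
    = a ^ (CARD('p) ^ m) + b ^ (CARD('p) ^ m) + of_nat CARD('p) * y"
proof (induction m)
  case 0
  show ?case
    using of_nat_in_qbar_integers[of 0, where 'a = 'p] by (intro bexI[of _ 0]) auto
next
  case (Suc m)
  define p where "p = CARD('p)"
  define P where "P = (of_nat p :: 'p padic_int fract alg_closure)"
  define A B where "A = a ^ (p ^ m)" and "B = b ^ (p ^ m)"
  have AB: "A \<in> qbar_integers" "B \<in> qbar_integers"
    unfolding A_def B_def by (intro qbar_integers_power assms)+
  have P: "P \<in> qbar_integers"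
    unfolding P_def by (rule of_nat_in_qbar_integers)
  obtain y where y: "y \<in> qbar_integers" "(a + b) ^ (p ^ m) = A + B + P * y"
    using Suc by (auto simp: p_def A_def B_def P_def)
  obtain y1 where y1: "y1 \<in> qbar_integers" "(A + B + P * y) ^ p = (A + B) ^ p + (P * y) ^ p + P * y1"
    using qbar_freshmans_dream[of "A + B" "P * y"] AB y(1) P
    by (auto simp: p_def P_def qbar_integers_add qbar_integers_mult)
  obtain y2 where y2: "y2 \<in> qbar_integers" "(A + B) ^ p = A ^ p + B ^ p + P * y2"
    using qbar_freshmans_dream[OF AB] by (auto simp: p_def P_def)
  \<comment> \<open>The previous error term, raised to the power p, keeps a factor p and can be
    absorbed into the new one.\<close>
  have "P ^ p = P * P ^ (p - 1)"
    by (simp add: power_eq_if p_def)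
  hence "(P * y) ^ p = P * (P ^ (p - 1) * y ^ p)"
    by (simp only: power_mult_distrib mult.assoc)
  hence "(a + b) ^ (p ^ Suc m) = A ^ p + B ^ p + P * (y1 + y2 + P ^ (p - 1) * y ^ p)"
    using y1(2) y2(2) by (simp only: power_Suc2 power_mult y(2) distrib_left add_ac)
  moreover have "y1 + y2 + P ^ (p - 1) * y ^ p \<in> qbar_integers"
    by (intro qbar_integers_add qbar_integers_mult qbar_integers_power y y1 y2 P)
  moreover have "A ^ p = a ^ (p ^ Suc m)" "B ^ p = b ^ (p ^ Suc m)"
    by (simp_all add: A_def B_def power_mult[symmetric] mult.commute)
  ultimately show ?case
    by (auto simp: p_def P_def)
qed

subsection \<open>The fifth cyclotomic polynomial\<close>

lemma poly_fifth_cyclotomic_mult: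
  "(z - 1) * (1 + z + z ^ 2 + z ^ 3 + z ^ 4) = (z ^ 5 - 1 :: 'a :: comm_ring_1)"
  by (simp add: algebra_simps eval_nat_numeral)

text \<open>As 5 is prime, a fifth root of unity is primitive as soon as it differs from 1;
  characteristic zero keeps 1 from being a root of the quartic.\<close>

lemma primitive_fifth_root_iff:
  fixes z :: "'a :: field_char_0"
  shows "primitive_root_of_unity 5 z \<longleftrightarrow> 1 + z + z ^ 2 + z ^ 3 + z ^ 4 = 0"
proof
  assume z: "primitive_root_of_unity 5 z"
  hence "z ^ 5 = 1" "z ^ 1 \<noteq> 1"
    unfolding primitive_root_of_unity_def by (blast, force)
  thus "1 + z + z ^ 2 + z ^ 3 + z ^ 4 = 0"
    using poly_fifth_cyclotomic_mult[of z] by auto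
next
  assume eq: "1 + z + z ^ 2 + z ^ 3 + z ^ 4 = 0"
  hence z5: "z ^ 5 = 1"
    using poly_fifth_cyclotomic_mult[of z] by simp
  have z1: "z \<noteq> 1"
  proof
    assume "z = 1"
    with eq have "(5 :: 'a) = 0" by simp
    thus False by simp
  qed
  have "z ^ k \<noteq> 1" if k: "0 < k" "k < 5" for k
  proof
    assume zk: "z ^ k = 1"
    have "\<not> 5 dvd k"
      using k by (auto dest: dvd_imp_le)
    hence "coprime k 5"
      using prime_imp_coprime[of 5 k] by (simp add: coprime_commute)
    \<comment> \<open>Inverting \<open>k\<close> modulo 5 recovers \<open>z\<close> as a power of
      z^k, so z^k = 1 would force z = 1.\<close>
    then obtain a b where ab: "k * a = 5 * b + 1"
      using k bezout_nat[of k 5] by auto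
    have "(z ^ k) ^ a = z * (z ^ 5) ^ b"
      by (simp add: power_mult[symmetric] ab)
    with zk z5 z1 show False by simp
  qed
  with z5 show "primitive_root_of_unity 5 z"
    by (simp add: primitive_root_of_unity_def)
qed

text \<open>The quartic is squarefree over the complex numbers, hence the product over its roots,
  which are the primitive fifth roots of unity. Coefficients are then compared through the injection
  of the integers.\<close>

lemma cyclotomic_5: "cyclotomic 5 = [:1, 1, 1, 1, 1:]"
proof -
  define f where "f = ([:1, 1, 1, 1, 1:] :: complex poly)"
  have root: "poly f z = 1 + z + z ^ 2 + z ^ 3 + z ^ 4" for z
    by (simp add: f_def algebra_simps eval_nat_numeral)
  have "poly (pderiv f) z \<noteq> 0" if z: "poly f z = 0" for z
  proof
    assume z': "poly (pderiv f) z = 0"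
    \<comment> \<open>Differentiating this identity at a common zero of \<open>f\<close> and its
      derivative gives 5 z^4 = 0, while \<open>f\<close> does not vanish at 0.\<close>
    have "[:- 1, 1:] * f = monom 1 5 - 1"
      by (simp add: f_def monom_altdef eval_nat_numeral one_pCons)
    hence "poly (pderiv ([:- 1, 1:] * f)) z = poly (pderiv (monom 1 5 - 1)) z"
      by simp
    hence "5 * z ^ 4 = 0"
      using z z' by (simp add: pderiv_mult pderiv_diff pderiv_monom poly_monom pderiv_pCons)
    hence "z = 0" by simp
    with z show False by (simp add: f_def)
  qed
  hence "rsquarefree f"
    by (auto simp: rsquarefree_roots)
  hence "smult (lead_coeff f) (\<Prod>z | poly f z = 0. [:- z, 1:]) = f"
    by (rule complex_poly_decompose_rsquarefree)
  hence f_prod: "(\<Prod>z | primitive_root_of_unity 5 z. [:- z, 1:]) = f"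
    by (simp add: primitive_fifth_root_iff root) (simp add: f_def)
  have f_int: "map_poly of_int [:1, 1, 1, 1, 1:] = f"
    by (simp add: f_def map_poly_pCons)
  show ?thesis
    unfolding cyclotomic_def
  proof (intro the_equality)
    fix g :: "int poly"
    assume "map_poly of_int g = (\<Prod>z | primitive_root_of_unity 5 z. [:- z :: complex, 1:])"
    hence "map_poly of_int g = (map_poly of_int [:1, 1, 1, 1, 1:] :: complex poly)"
      using f_prod f_int by (simp only:)
    hence "complex_of_int (coeff g n) = complex_of_int (coeff [:1, 1, 1, 1, 1:] n)" for n
      by (metis coeff_map_poly of_int_0)
    thus "g = [:1, 1, 1, 1, 1:]"
      by (intro poly_eqI) (simp only: of_int_eq_iff)
  qed (simp only: f_prod f_int)
qed

lemma exists_primitive_fifth_root: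
  "\<exists>z :: 'a :: {alg_closed_field, field_char_0}. primitive_root_of_unity 5 z"
proof -
  obtain z :: 'a where "poly [:1, 1, 1, 1, 1:] z = 0"
    using alg_closed_imp_poly_has_root[of "[:1, 1, 1, 1, 1:]"] by auto
  hence "1 + z + z ^ 2 + z ^ 3 + z ^ 4 = 0"
    by (simp add: algebra_simps power2_eq_square power3_eq_cube power4_eq_xxxx)
  thus ?thesis
    using primitive_fifth_root_iff by blast
qed

lemma poly_cyclotomic_5:
  "poly (map_poly of_int (cyclotomic 5)) z = (1 + z + z ^ 2 + z ^ 3 + z ^ 4 :: 'a :: comm_ring_1)"
  by (simp add: cyclotomic_5 map_poly_pCons) (simp add: algebra_simps eval_nat_numeral)

subsection \<open>The test polynomial\<close>

lemma to_fract_third: "to_fract (x / 3 :: Z5) = to_fract x / 3"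
  by (subst padic_hom_divide) (simp_all add: padic_res_numeral CARD_five)

lemma to_fract_ninth: "to_fract (x / 9 :: Z5) = to_fract x / 9"
  by (subst padic_hom_divide) (simp_all add: padic_res_numeral CARD_five)

text \<open>The arithmetic is done in the fraction field, where division is total and
  \<open>simp\<close> can normalise; injectivity of \<open>to_fract\<close> brings the result
  back.\<close>

lemma P5_at_1: "poly P5 1 = 5 / 9"
proof -
  have "to_fract (poly P5 1) = to_fract (5 / 9)"
    by (simp add: P5_def to_fract_third to_fract_ninth)
  thus ?thesis by simp
qed

lemma P5_at_minus_1: "poly P5 (-1) = 89 / 9"
proof -
  have "to_fract (poly P5 (-1)) = to_fract (89 / 9)"
    by (simp add: P5_def to_fract_third to_fract_ninth)
  thus ?thesis by simp
qed

lemma P5_fract: "(map_poly to_fract P5 :: Q5 poly) = [:1, - (7 / 3), 29 / 9, - (7 / 3), 1:]"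
  by (simp add: P5_def map_poly_pCons to_fract_third to_fract_ninth)

lemma P5_coprime: "coprime (map_poly to_fract P5 :: Q5 poly) ([:0, 1:] ^ 2 - 1)"
proof (rule coprimeI)
  fix d :: "Q5 poly"
  assume d: "d dvd map_poly to_fract P5" "d dvd [:0, 1:] ^ 2 - 1"
  \<comment> \<open>An explicit Bezout identity. The linear cofactor is 89 at 1 and 5 at -1, so its
    product with P_5 equals 445/9 at both roots of A^2 - 1; the other cofactor is the quotient. The
    constant is a unit in Q_5, though not in Z_5.\<close>
  have "map_poly to_fract P5 * [:47, 42:] - ([:0, 1:] ^ 2 - 1) * [:22 / 9, 203 / 3, - 51, 42:]
     = ([:445 / 9:] :: Q5 poly)"
    by (simp add: P5_fract power2_eq_square one_pCons)
  hence "d dvd [:445 / 9:]"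
    using d by (metis dvd_diff dvd_mult2)
  moreover have "[:445 / 9:] dvd (1 :: Q5 poly)"
    by (simp add: is_unit_const_poly_iff)
  ultimately show "d dvd 1"
    by (rule dvd_trans)
qed

subsection \<open>The resultant\<close>

text \<open>With roots a, b of the quadratic, ab = 1 and a + b = s, so the palindromic quartic is
  a^2 h(s) at a and b^2 h(s) at b, where h(u) = u^2 - cu + d - 2. The product is h(s)^2.\<close>

lemma res_monic_palindromic:
  fixes s c d :: "'a :: field"
  shows "res_monic [:1, - s, 1:] [:1, - c, d, - c, 1:] = (s ^ 2 - c * s + d - 2) ^ 2"
proof -
  have "degree [:1, - to_ac s, 1:] > 0" by simp
  then obtain a where "poly [:1, - to_ac s, 1:] a = 0"
    using alg_closed_imp_poly_has_root by blast
  define b where "b = to_ac s - a"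
  have ab: "a * b = 1"
    using \<open>poly [:1, - to_ac s, 1:] a = 0\<close> by (simp add: b_def algebra_simps)
  have s: "to_ac s = a + b" by (simp add: b_def)
  have fact: "map_poly to_ac [:1, - s, 1:] = [:- a, 1:] * [:- b, 1:]"
    using ab by (simp add: map_poly_pCons s mult.commute)
  \<comment> \<open>Roots are counted with multiplicity, so the case a = b is covered.\<close>
  have roots: "proots (map_poly to_ac [:1, - s, 1:]) = {#a, b#}"
    unfolding fact by (subst proots_mult) (simp_all del: mult_pCons_left mult_pCons_right)
  define g where "g = map_poly to_ac [:1, - c, d, - c, 1:]"
  have g: "poly g x = 1 - to_ac c * x + to_ac d * x ^ 2 - to_ac c * x ^ 3 + x ^ 4" for x
    by (simp add: g_def map_poly_pCons algebra_simps eval_nat_numeral)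
  define h where "h = to_ac (s ^ 2 - c * s + d - 2)"
  have h: "h = (a + b) ^ 2 - to_ac c * (a + b) + to_ac d - 2 * (a * b)"
    by (simp add: h_def s ab)
  have val: "poly g x = x ^ 2 * h" if "x * y = 1" "h = (x + y) ^ 2 - to_ac c * (x + y) + to_ac d - 2 * (x * y)" for x y
  proof -
    have "x ^ 2 * h = x ^ 4 + (x * y) * (x * y) - to_ac c * (x ^ 3 + x * (x * y)) + to_ac d * x ^ 2"
      unfolding that(2) by (simp add: algebra_simps eval_nat_numeral)
    thus ?thesis unfolding that(1) by (simp add: g algebra_simps)
  qed
  have ga: "poly g a = a ^ 2 * h"
    using ab h by (rule val)
  have gb: "poly g b = b ^ 2 * h"
    using ab h by (intro val[of b a]) (simp_all only: mult.commute add.commute)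
  have "poly g a * poly g b = (a * b) ^ 2 * h ^ 2"
    unfolding ga gb by (simp add: power2_eq_square mult_ac)
  also have "\<dots> = to_ac ((s ^ 2 - c * s + d - 2) ^ 2)"
    by (simp add: ab h_def)
  finally have "of_ac (poly g a * poly g b) = (s ^ 2 - c * s + d - 2) ^ 2"
    by (simp only: of_ac_to_ac)
  thus ?thesis
    unfolding res_monic_def roots g_def[symmetric] by simp
qed

lemma z_elem_nonzero: "z_elem \<noteq> 0"
proof
  assume "z_elem = 0"
  hence "fps_nth (1 + fps_X :: Z5 fps) 0 = 0"
    by (simp only: z_elem_def to_fract_eq_0_iff fps_zero_nth)
  thus False by simp
qed

lemma to_fract_fps_const_numeral: "to_fract (fps_const (numeral k)) = numeral k"
  by (simp flip: numeral_fps_const)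

lemma P5_fract_fps:
  "map_poly (\<lambda>c. to_fract (fps_const c)) P5 = [:1, - (7 / 3), 29 / 9, - (7 / 3), 1 :: Z5 fps fract:]"
proof -
  have mult: "to_fract (fps_const (x * y)) = to_fract (fps_const x) * to_fract (fps_const y)" for x y :: Z5
    by (simp flip: to_fract_mult)
  have minus: "to_fract (fps_const (- x)) = - to_fract (fps_const x)" for x :: Z5
    by (simp flip: fps_const_neg)
  have "to_fract (fps_const (x / 3 :: Z5)) = to_fract (fps_const x) / 3" for x
    by (subst padic_hom_divide[where h = "\<lambda>c. to_fract (fps_const c)", OF _ mult])
       (simp_all add: padic_res_numeral CARD_five to_fract_fps_const_numeral)
  moreover have "to_fract (fps_const (x / 9 :: Z5)) = to_fract (fps_const x) / 9" for x
    by (subst padic_hom_divide[where h = "\<lambda>c. to_fract (fps_const c)", OF _ mult])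
       (simp_all add: padic_res_numeral CARD_five to_fract_fps_const_numeral)
  ultimately show ?thesis
    by (simp add: P5_def map_poly_pCons to_fract_fps_const_numeral minus)
qed

text \<open>In terms of w = z + 1/z the left side is (w^2 + w - 1)/9, and z^2 (w^2 + w - 1) is the
  fifth cyclotomic polynomial at z.\<close>

lemma spectral_value_identity:
  fixes z :: "'a :: field_char_0"
  assumes z: "z \<noteq> 0"
  defines "s \<equiv> (z + inverse z + 4) / 3"
  shows "s ^ 2 - 7 / 3 * s + 29 / 9 - 2 = (1 + z + z ^ 2 + z ^ 3 + z ^ 4) / (9 * z ^ 2)"
  using z by (simp add: s_def field_simps) (simp add: algebra_simps eval_nat_numeral)

lemma R_X_P5: "R_X P5 = (1 + z_elem + z_elem ^ 2 + z_elem ^ 3 + z_elem ^ 4) ^ 2 / (81 * z_elem ^ 4)"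
proof -
  have spectral: "spectral_poly_X = [:1, - ((z_elem + inverse z_elem + 4) / 3), 1:]"
    by (simp add: spectral_poly_X_def power2_eq_square one_pCons)
  have "R_X P5 = ((1 + z_elem + z_elem ^ 2 + z_elem ^ 3 + z_elem ^ 4) / (9 * z_elem ^ 2)) ^ 2"
    unfolding R_X_def P5_fract_fps spectral res_monic_palindromic
      spectral_value_identity[OF z_elem_nonzero] ..
  thus ?thesis
    by (simp add: power_divide power_mult_distrib flip: power_mult)
qed

subsection \<open>Iwasawa invariants\<close>

lemma comm_ring_hom_residue:
  "comm_ring_hom (\<lambda>c :: 'p :: prime_card padic_int. of_int (padic_res c 1) :: 'p mod_ring)"
proof -
  have red: "(of_int (k mod int CARD('p)) :: 'p mod_ring) = of_int k" for k
    by transfer simp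
  have "padic_res (1 :: 'p padic_int) 1 = 1"
    using padic_res_of_nat[of 1 1, where 'p = 'p] prime_gt_1_int[OF prime_card_int[where 'a = 'p]] by simp
  thus ?thesis
    by unfold_locales
       (simp_all add: zero_padic_int.rep_eq plus_padic_int.rep_eq times_padic_int.rep_eq red)
qed

lemma fps_mod_p_mult: "fps_mod_p (F * G) = fps_mod_p F * fps_mod_p (G :: 'p :: prime_card padic_int fps)"
proof -
  interpret comm_ring_hom "\<lambda>c :: 'p padic_int. of_int (padic_res c 1) :: 'p mod_ring"
    by (rule comm_ring_hom_residue)
  show ?thesis
    by (rule fps_ext) (simp only: fps_mod_p_def fps_nth_Abs_fps fps_mult_nth hom_sum hom_mult)
qed

lemma fps_mod_p_of_poly:
  "fps_mod_p (fps_of_poly f) = fps_of_poly (map_poly (\<lambda>c. of_int (padic_res c 1)) f)"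
  by (rule fps_ext) (simp add: fps_mod_p_def coeff_map_poly zero_padic_int.rep_eq)

lemma fps_mod_p_eq_0:
  assumes "of_nat CARD('p) dvd (F :: 'p :: prime_card padic_int fps)"
  shows "fps_mod_p F = 0"
proof -
  obtain H where H: "F = fps_const (of_nat CARD('p)) * H"
    using assms by (auto simp: fps_of_nat)
  have "fps_mod_p (fps_const (of_nat CARD('p) :: 'p padic_int)) = 0"
    by (rule fps_ext) (simp add: fps_mod_p_def padic_res_of_nat zero_padic_int.rep_eq)
  thus ?thesis by (simp add: H fps_mod_p_mult)
qed

text \<open>A nonzero reduction means that p does not divide \<open>F\<close>, so N = 0 in every
  factorisation F = p^N F0. This determines both definite descriptions.\<close>

lemma iwasawa_invariants:
  assumes F: "fps_mod_p (F :: 'p :: prime_card padic_int fps) \<noteq> 0"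
  shows "mu_inv F = 0" "lambda_inv F = subdegree (fps_mod_p F)"
proof -
  have F_dvd: "\<not> of_nat CARD('p) dvd F"
    using F fps_mod_p_eq_0 by blast
  have N: "N = 0" if "F = of_nat CARD('p) ^ N * F0" for N F0
    using that F_dvd by (cases N) (auto simp: mult.assoc)
  show "mu_inv F = 0"
    unfolding mu_inv_def using F_dvd N by (intro the_equality) (auto intro!: exI[of _ F])
  show "lambda_inv F = subdegree (fps_mod_p F)"
    unfolding lambda_inv_def
  proof (intro the_equality)
    show "\<exists>N F0. F = of_nat CARD('p) ^ N * F0 \<and> \<not> of_nat CARD('p) dvd F0 \<and>
        subdegree (fps_mod_p F) = subdegree (fps_mod_p F0)"
      using F_dvd by (intro exI[of _ 0] exI[of _ F]) simp
  next
    fix l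
    assume "\<exists>N F0. F = of_nat CARD('p) ^ N * F0 \<and> \<not> of_nat CARD('p) dvd F0 \<and>
        l = subdegree (fps_mod_p F0)"
    then obtain N F0 where "F = of_nat CARD('p) ^ N * F0" "l = subdegree (fps_mod_p F0)"
      by blast
    with N[of N F0] show "l = subdegree (fps_mod_p F)" by simp
  qed
qed

subsection \<open>The resultant as a power series\<close>

text \<open>The base is ((1 + T)^5 - 1)/T, the cyclotomic polynomial at 1 + T in expanded form, so
  that its reduction T^4 modulo 5 is visible.\<close>

definition R_numer :: "Z5 poly" where "R_numer = [:5, 10, 10, 5, 1:] ^ 2"

definition R_denom :: "Z5 poly" where "R_denom = [:81:] * [:1, 1:] ^ 4"

lemma R_numer_alt: "R_numer = (1 + [:1, 1:] + [:1, 1:] ^ 2 + [:1, 1:] ^ 3 + [:1, 1:] ^ 4) ^ 2"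
  by (simp add: R_numer_def eval_nat_numeral one_pCons)

lemma fps_of_poly_one_plus_X: "fps_of_poly [:1, 1:] = (1 + fps_X :: 'a :: comm_ring_1 fps)"
  by (simp add: fps_of_poly_pCons)

lemma fps_of_R_numer:
  "fps_of_poly R_numer = (1 + (1 + fps_X) + (1 + fps_X) ^ 2 + (1 + fps_X) ^ 3 + (1 + fps_X) ^ 4) ^ 2"
  by (simp only: R_numer_alt fps_of_poly_power fps_of_poly_add fps_of_poly_1 fps_of_poly_one_plus_X)

lemma fps_of_R_denom: "fps_of_poly R_denom = 81 * (1 + fps_X) ^ 4"
  by (simp only: R_denom_def fps_of_poly_power fps_of_poly_mult fps_of_poly_numeral' fps_of_poly_one_plus_X)

text \<open>The denominator 81 (1 + T)^4 is invertible in Z_5[[T]]: 81 is a unit of Z_5, and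
  \<open>G\<close> is the geometric series inverting 1 + T.\<close>

lemma R_X_power_series:
  obtains F where "fps_of_poly R_denom * F = fps_of_poly R_numer" "to_fract F = R_X P5"
proof -
  define G :: "Z5 fps" where "G = Abs_fps (\<lambda>n. (- 1) ^ n)"
  have G: "(1 + fps_X) * G = 1"
  proof (rule fps_ext)
    fix n show "fps_nth ((1 + fps_X) * G) n = fps_nth 1 n"
      by (cases n) (simp_all add: G_def distrib_right)
  qed
  have "(81 :: Z5) * inverse 81 = 1"
    by (rule padic_unit_inverse) (simp add: padic_is_unit_iff padic_res_numeral CARD_five)
  hence c: "(81 :: Z5 fps) * fps_const (inverse 81) = 1"
    by (simp add: numeral_fps_const)
  define F where "F = (fps_const (inverse 81) * G ^ 4) * fps_of_poly R_numer"
  have "fps_of_poly R_denom * F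
      = (81 * fps_const (inverse 81)) * ((1 + fps_X) * G) ^ 4 * fps_of_poly R_numer"
    unfolding fps_of_R_denom F_def power_mult_distrib by (simp only: mult_ac)
  also have "\<dots> = fps_of_poly R_numer"
    by (simp only: G c power_one mult_1)
  finally have F: "fps_of_poly R_denom * F = fps_of_poly R_numer" .
  have "81 * z_elem ^ 4 * to_fract F = (1 + z_elem + z_elem ^ 2 + z_elem ^ 3 + z_elem ^ 4) ^ 2"
    using arg_cong[OF F, of to_fract]
    by (simp only: fps_of_R_denom fps_of_R_numer z_elem_def to_fract_mult to_fract_power to_fract_add
        to_fract_1 to_fract_numeral)
  hence "to_fract F = R_X P5"
    using z_elem_nonzero by (simp add: R_X_P5 field_simps)
  with F show ?thesis by (rule that)
qed

text \<open>Modulo 5 the numerator becomes T^8 and the denominator has constant term 81 = 1, so the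
  whole order 8 falls on \<open>F\<close>.\<close>

lemma R_X_invariants:
  assumes F: "fps_of_poly R_denom * F = fps_of_poly R_numer"
  shows "mu_inv F = 0" "lambda_inv F = 8"
proof -
  define r where "r = (\<lambda>c :: Z5. of_int (padic_res c 1) :: F5)"
  interpret r: comm_ring_hom r
    unfolding r_def by (rule comm_ring_hom_residue)
  interpret rp: map_poly_comm_ring_hom r ..
  have mod_of_poly: "fps_mod_p (fps_of_poly f) = fps_of_poly (map_poly r f)" for f
    by (simp add: fps_mod_p_of_poly r_def)
  have r_num: "r (numeral k) = of_int (numeral k mod 5)" for k
    by (simp add: r_def padic_res_numeral CARD_five)
  have "map_poly r [:5, 10, 10, 5, 1:] = monom 1 4"
    by (simp add: map_poly_pCons r_num monom_altdef eval_nat_numeral)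
  hence "map_poly r R_numer = monom 1 8"
    by (simp add: R_numer_def rp.hom_power monom_power)
  hence numer: "fps_mod_p (fps_of_poly R_numer) = fps_X ^ 8"
    by (simp add: mod_of_poly fps_of_poly_monom')
  have "fps_nth (fps_mod_p (fps_of_poly R_denom)) 0 = r (coeff R_denom 0)"
    by (simp add: mod_of_poly coeff_map_poly)
  also have "\<dots> = 1"
    by (simp add: R_denom_def r_num coeff_0_power flip: poly_0_coeff_0)
  finally have "fps_nth (fps_mod_p (fps_of_poly R_denom)) 0 \<noteq> 0" by simp
  hence "subdegree (fps_mod_p (fps_of_poly R_denom)) = 0" "fps_mod_p (fps_of_poly R_denom) \<noteq> 0"
    by auto
  moreover have prod: "fps_mod_p (fps_of_poly R_denom) * fps_mod_p F = fps_X ^ 8"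
    using F by (simp flip: fps_mod_p_mult add: numer)
  moreover from prod have nz: "fps_mod_p F \<noteq> 0" by auto
  ultimately have "subdegree (fps_mod_p F) = 8"
    by (metis add_0 fps_X_power_subdegree subdegree_mult)
  thus "mu_inv F = 0" "lambda_inv F = 8"
    using iwasawa_invariants[OF nz] by simp_all
qed

lemma R_X_evaluation:
  fixes \<zeta> :: Q5_bar
  assumes F: "fps_of_poly R_denom * F = fps_of_poly R_numer"
    and \<zeta>: "\<zeta> ^ (5 ^ m) = 1"
  shows "fps_padic_sums F (\<zeta> - 1) ((1 + \<zeta> + \<zeta> ^ 2 + \<zeta> ^ 3 + \<zeta> ^ 4) ^ 2 / (81 * \<zeta> ^ 4))"
proof -
  interpret hom: comm_ring_hom to_qbar
    by (rule comm_ring_hom_to_qbar)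
  interpret P: map_poly_comm_ring_hom to_qbar ..
  define x where "x = \<zeta> - 1"
  have \<zeta>_int: "\<zeta> \<in> qbar_integers"
    using \<zeta> by (rule root_of_unity_in_qbar_integers) simp
  have x_int: "x \<in> qbar_integers"
    unfolding x_def by (intro qbar_integers_diff \<zeta>_int one_in_qbar_integers)
  have \<zeta>0: "\<zeta> \<noteq> 0"
    using \<zeta> by (auto simp: power_0_left)
  \<comment> \<open>The exponent 5^m is odd, so zeta^(5^m) + (-1)^(5^m) = 0 and only the multiple of
    5 remains.\<close>
  obtain y where y: "y \<in> qbar_integers" "x ^ (5 ^ m) = of_nat CARD(five) * y"
    using qbar_frobenius_power[OF \<zeta>_int qbar_integers_uminus[OF one_in_qbar_integers], of m] \<zeta>
    by (auto simp: CARD_five x_def)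
  have lin: "poly (map_poly to_qbar [:1, 1:]) x = \<zeta>"
    by (simp add: x_def map_poly_pCons)
  have numer: "poly (map_poly to_qbar R_numer) x = (1 + \<zeta> + \<zeta> ^ 2 + \<zeta> ^ 3 + \<zeta> ^ 4) ^ 2"
    by (simp only: R_numer_alt P.hom_power P.hom_add P.hom_one poly_power poly_add poly_1 lin)
  have denom: "poly (map_poly to_qbar R_denom) x = 81 * \<zeta> ^ 4"
    by (simp only: R_denom_def P.hom_power P.hom_mult poly_power poly_mult lin)
       (simp add: map_poly_pCons)
  have "to_qbar (81 * inverse 81 :: Z5) = 1"
    by (subst padic_unit_inverse) (simp_all add: padic_is_unit_iff padic_res_numeral CARD_five)
  hence "81 * to_qbar (inverse 81) = (1 :: Q5_bar)"
    by (simp only: to_fract_mult to_ac_mult to_fract_numeral to_ac_numeral)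
  hence inv81: "(inverse 81 :: Q5_bar) = to_qbar (inverse 81)"
    by (rule inverse_unique)
  have "5 ^ m = Suc (5 ^ m - 1)" by simp
  hence "\<zeta> * \<zeta> ^ (5 ^ m - 1) = 1"
    using \<zeta> by (metis power_Suc)
  \<comment> \<open>Being a power of zeta, the inverse is integral; with 81 a unit of Z_5 this makes
    the inverse of the denominator integral.\<close>
  hence inv\<zeta>: "inverse \<zeta> = \<zeta> ^ (5 ^ m - 1)"
    by (rule inverse_unique)
  have "inverse (81 * \<zeta> ^ 4) = to_qbar (inverse 81) * (\<zeta> ^ (5 ^ m - 1)) ^ 4"
    by (simp only: inverse_mult_distrib power_inverse[symmetric] inv\<zeta> inv81)
  also have "\<dots> \<in> qbar_integers"
    by (intro qbar_integers_mult qbar_integers_power to_qbar_in_integers \<zeta>_int)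
  finally have "inverse (poly (map_poly to_qbar R_denom) x) \<in> qbar_integers"
    by (simp only: denom)
  moreover have "poly (map_poly to_qbar R_denom) x \<noteq> 0"
    using \<zeta>0 by (simp add: denom)
  ultimately have "fps_padic_sums F x
      (poly (map_poly to_qbar R_numer) x / poly (map_poly to_qbar R_denom) x)"
    using fps_padic_sums_rational[OF F x_int y(2,1)] by blast
  thus ?thesis unfolding numer denom unfolding x_def .
qed

subsection \<open>Eigenvectors of the Grover matrix on a layer\<close>

text \<open>Reindexing along a listing turns the matrix product into a sum over arcs, so one
  eigenfunction on arcs serves every listing.\<close>

lemma grover_eigenvalueI:
  fixes \<phi> :: "'e \<Rightarrow> 'a :: field"
  assumes fin: "finite (arcs G)"
    and eig: "\<And>e. e \<in> arcs G \<Longrightarrow> (\<Sum>f\<in>arcs G. grover_entry G \<iota> e f * \<phi> f) = k * \<phi> e"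
    and e0: "e0 \<in> arcs G" "\<phi> e0 \<noteq> 0"
  shows "grover_eigenvalue G \<iota> k"
  unfolding grover_eigenvalue_def
proof (intro conjI allI impI fin)
  fix es assume es: "distinct es \<and> set es = arcs G"
  define n where "n = length es"
  define M :: "'a mat" where "M = grover_mat G \<iota> es"
  define v where "v = vec n (\<lambda>i. \<phi> (es ! i))"
  have bij: "bij_betw ((!) es) {..<n} (arcs G)"
    using es by (auto simp: n_def intro: bij_betw_nth)
  have "M *\<^sub>v v = k \<cdot>\<^sub>v v"
  proof (rule eq_vecI)
    fix i assume "i < dim_vec (k \<cdot>\<^sub>v v)"
    hence i: "i < n" by (simp add: v_def)
    have "(M *\<^sub>v v) $ i = (\<Sum>j<n. grover_entry G \<iota> (es ! i) (es ! j) * \<phi> (es ! j))"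
      using i by (simp add: M_def grover_mat_def v_def scalar_prod_def atLeast0LessThan n_def)
    also have "\<dots> = (\<Sum>f\<in>arcs G. grover_entry G \<iota> (es ! i) f * \<phi> f)"
      by (rule sum.reindex_bij_betw[OF bij])
    also have "\<dots> = k * \<phi> (es ! i)"
      using es i by (intro eig) (auto simp: n_def)
    finally show "(M *\<^sub>v v) $ i = (k \<cdot>\<^sub>v v) $ i"
      using i by (simp add: v_def)
  qed (simp add: M_def grover_mat_def v_def n_def)
  moreover have "v \<noteq> 0\<^sub>v n"
  proof
    assume v0: "v = 0\<^sub>v n"
    have "e0 \<in> (!) es ` {..<n}"
      using e0(1) by (simp only: bij_betw_imp_surj_on[OF bij])
    then obtain i where "i < n" "es ! i = e0" by auto
    hence "v $ i = \<phi> e0" by (simp add: v_def)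
    with v0 \<open>i < n\<close> e0(2) show False by simp
  qed
  ultimately show "eigenvalue (grover_mat G \<iota> es) k"
    unfolding eigenvalue_def eigenvector_def M_def[symmetric]
    by (intro exI[of _ v]) (simp add: v_def M_def grover_mat_def n_def)
qed

lemma UNIV_loop: "(UNIV :: loop set) = {S0, S1, S2, S0_bar, S1_bar, S2_bar}"
proof -
  have "e \<in> {S0, S1, S2, S0_bar, S1_bar, S2_bar}" for e
    by (cases e) simp_all
  thus ?thesis by blast
qed

lemma out_degree_layer:
  assumes "g \<in> {0..<5 ^ n}"
  shows "out_degree (layer X_graph voltage n) ((), g) = 6"
proof -
  have "out_arcs (layer X_graph voltage n) ((), g) = (\<lambda>e. (e, g)) ` UNIV"
    using assms by (auto simp: out_arcs_def layer_def X_graph_def CARD_five)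
  hence "out_degree (layer X_graph voltage n) ((), g) = card (UNIV :: loop set)"
    unfolding out_degree_def by (simp add: card_image inj_on_def)
  thus ?thesis by (simp add: UNIV_loop)
qed

text \<open>The eigenvector is the character \<open>g \<mapsto> z\<^sup>g\<close> of the deck group times the vector
  \<open>a - z\<^bsup>\<alpha>(e)\<^esup>\<close> on the loops, which solves the eigenvalue equation of the twisted Grover matrix
  of the base digraph.\<close>

lemma layer_eigenvalue:
  fixes a z :: "'a :: field_char_0"
  assumes n: "n \<ge> 1" and z: "z ^ 5 = 1" and a: "a \<noteq> 1"
    and spec: "a * (z + inverse z + 4) = 3 * (a ^ 2 + 1)"
  shows "grover_eigenvalue (layer X_graph voltage n) (layer_rev X_graph loop_rev voltage n) a"
proof -
  define L where "L = layer X_graph voltage n"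
  define \<iota> where "\<iota> = layer_rev X_graph loop_rev voltage n"
  define q where "q = (5 :: int) ^ n"
  define \<chi> where "\<chi> = (\<lambda>k. z powi k)"
  define r where "r = (\<lambda>e. padic_res (voltage e) n)"
  define \<phi> where "\<phi> = (\<lambda>(e, g). \<chi> g * (a - \<chi> (r e)))"
  have q0: "q > 0" by (simp add: q_def)
  have z0: "z \<noteq> 0" using z by auto
  have \<chi>_add: "\<chi> (k + l) = \<chi> k * \<chi> l" for k l
    using z0 by (simp add: \<chi>_def power_int_add)
  have \<chi>_minus: "\<chi> (- k) = inverse (\<chi> k)" for k
    by (simp add: \<chi>_def power_int_minus)
  have \<chi>_nz: "\<chi> k \<noteq> 0" for k
    using z0 by (simp add: \<chi>_def)
  have "\<chi> q = z ^ (5 ^ n)"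
    by (simp add: \<chi>_def q_def flip: power_int_of_nat)
  \<comment> \<open>For n >= 1 the order of z divides 5^n, so the character descends to
    Z/5^n.\<close>
  also have "(5 :: nat) ^ n = 5 * 5 ^ (n - 1)"
    using n by (cases n) auto
  also have "z ^ (5 * 5 ^ (n - 1)) = 1"
    by (simp only: power_mult z power_one)
  finally have \<chi>_q: "\<chi> q = 1" .
  have \<chi>_mod: "\<chi> (k mod q) = \<chi> k" for k
  proof -
    have "\<chi> (q * (k div q)) = (\<chi> q) powi (k div q)"
      by (simp add: \<chi>_def power_int_mult)
    hence "\<chi> (q * (k div q)) = 1"
      by (simp add: \<chi>_q)
    hence "\<chi> (q * (k div q) + k mod q) = \<chi> (k mod q)"
      by (simp only: \<chi>_add mult_1)
    thus ?thesis by simp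
  qed
  have q1: "q > 1" using n by (simp add: q_def)
  have \<chi>_r: "\<chi> (r S0) = z" "\<chi> (r S0_bar) = inverse z"
    "\<chi> (r S1) = 1" "\<chi> (r S1_bar) = 1" "\<chi> (r S2) = 1" "\<chi> (r S2_bar) = 1"
  proof -
    have r0: "r S0 = 1"
      using q1 by (simp add: r_def one_padic_int.rep_eq CARD_five q_def)
    thus "\<chi> (r S0) = z" by (simp add: \<chi>_def)
    have "r S0_bar = (- 1) mod q"
      using r0 by (simp add: r_def uminus_padic_int.rep_eq CARD_five q_def)
    thus "\<chi> (r S0_bar) = inverse z"
      by (simp only: \<chi>_mod) (simp add: \<chi>_def power_int_minus)
  qed (simp_all add: r_def zero_padic_int.rep_eq \<chi>_def)
  have \<chi>_rev: "\<chi> (r (loop_rev e)) = inverse (\<chi> (r e))" for e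
    by (cases e) (simp_all add: \<chi>_r)
  have arcs_L: "arcs L = UNIV \<times> {0..<q}"
    by (simp add: L_def layer_def X_graph_def CARD_five q_def)
  have fin: "finite (arcs L)"
    by (simp add: arcs_L UNIV_loop)
  have \<iota>: "\<iota> (e, g) = (loop_rev e, (g + r e) mod q)" if "g \<in> {0..<q}" for e g
    using that arcs_L by (simp add: \<iota>_def layer_rev_def L_def r_def CARD_five q_def)
  have tail: "tail L (e, g) = ((), g)" for e g
    by (simp add: L_def layer_def)
  have head: "head L (e, g) = ((), (g + r e) mod q)" for e g
    by (simp add: L_def layer_def r_def CARD_five q_def)
  \<comment> \<open>Out-degree 6 gives the weight 2/6 = 1/3. The inverse arc always ends at the
    origin of (e, g), so its correction can be taken out of the incidence condition.\<close>
  have entry: "grover_entry L \<iota> (e, g) (h, k)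
      = (if k = (g - r h) mod q then 1 / 3 else 0) - (if (h, k) = \<iota> (e, g) then 1 else (0 :: 'a))"
    if g: "g \<in> {0..<q}" and k: "k \<in> {0..<q}" for e g h k
  proof -
    have *: "(k + r h) mod q = g \<longleftrightarrow> k = (g - r h) mod q"
    proof
      assume "(k + r h) mod q = g"
      hence "(g - r h) mod q = k mod q"
        by (metis add_diff_cancel_right' mod_diff_left_eq)
      thus "k = (g - r h) mod q" using k by simp
    next
      assume "k = (g - r h) mod q"
      hence "(k + r h) mod q = g mod q"
        by (simp add: mod_simps)
      thus "(k + r h) mod q = g" using g by simp
    qed
    have rev: "(k + r h) mod q = g" if "(h, k) = \<iota> (e, g)"
    proof -
      have hk: "h = loop_rev e" "k = (g + r e) mod q"
        using that \<iota>[OF g] by simp_all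
      have "r h = (- r e) mod q"
        by (simp add: hk r_def voltage_rev uminus_padic_int.rep_eq CARD_five q_def)
      thus ?thesis using g by (simp add: hk(2) mod_simps)
    qed
    have "out_degree L ((), g) = 6"
      unfolding L_def by (rule out_degree_layer) (use g in \<open>simp add: q_def\<close>)
    thus ?thesis
      using rev unfolding grover_entry_def head tail *[symmetric] by auto
  qed
  have eig: "(\<Sum>f\<in>arcs L. grover_entry L \<iota> e f * \<phi> f) = a * \<phi> e" if e_arc: "e \<in> arcs L" for e
  proof -
    obtain e' g where e: "e = (e', g)" and g: "g \<in> {0..<q}"
      using e_arc by (auto simp: arcs_L)
    have \<iota>_arc: "\<iota> (e', g) \<in> arcs L"
      using q0 by (simp add: \<iota>[OF g] arcs_L)
    have "(\<Sum>f\<in>arcs L. grover_entry L \<iota> e f * \<phi> f)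
        = (\<Sum>(h, k)\<in>arcs L. (if k = (g - r h) mod q then 1 / 3 else 0) * \<phi> (h, k)
            - (if (h, k) = \<iota> (e', g) then 1 else 0) * \<phi> (h, k))"
      by (intro sum.cong refl) (auto simp: e entry[OF g] arcs_L left_diff_distrib)
    also have "\<dots> = (\<Sum>(h, k)\<in>arcs L. (if k = (g - r h) mod q then 1 / 3 else 0) * \<phi> (h, k))
        - (\<Sum>f\<in>arcs L. (if f = \<iota> (e', g) then 1 else 0) * \<phi> f)"
      by (simp add: sum_subtractf case_prod_beta)
    also have "(\<Sum>f\<in>arcs L. (if f = \<iota> (e', g) then 1 else 0) * \<phi> f)
        = (\<Sum>f\<in>arcs L. if f = \<iota> (e', g) then \<phi> f else 0)"
      by (intro sum.cong) auto
    also have "\<dots> = \<phi> (\<iota> (e', g))"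
      using fin \<iota>_arc by simp
    also have "\<phi> (\<iota> (e', g)) = \<chi> g * (a * \<chi> (r e') - 1)"
      using \<chi>_nz by (simp add: \<iota>[OF g] \<phi>_def \<chi>_mod \<chi>_add \<chi>_rev field_simps)
    also have "(\<Sum>(h, k)\<in>arcs L. (if k = (g - r h) mod q then 1 / 3 else 0) * \<phi> (h, k))
        = (\<Sum>h\<in>UNIV. \<Sum>k\<in>{0..<q}. (if k = (g - r h) mod q then 1 / 3 else 0) * \<phi> (h, k))"
      unfolding arcs_L by (rule sum.cartesian_product[symmetric])
    \<comment> \<open>Exactly one lift of each loop \<open>h\<close> ends over \<open>g\<close>,
      namely the one starting at g - r h modulo q.\<close>
    also have "\<dots> = (\<Sum>h\<in>UNIV. 1 / 3 * \<chi> g * (a * inverse (\<chi> (r h)) - 1))"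
    proof (intro sum.cong refl)
      fix h
      have "(\<Sum>k\<in>{0..<q}. (if k = (g - r h) mod q then 1 / 3 else 0) * \<phi> (h, k))
          = (\<Sum>k\<in>{0..<q}. if k = (g - r h) mod q then 1 / 3 * \<phi> (h, k) else 0)"
        by (intro sum.cong) auto
      also have "\<dots> = 1 / 3 * \<phi> (h, (g - r h) mod q)"
        using q0 by simp
      also have "\<phi> (h, (g - r h) mod q) = \<chi> g * inverse (\<chi> (r h)) * (a - \<chi> (r h))"
        using \<chi>_add[of g "- r h"] by (simp add: \<phi>_def \<chi>_mod \<chi>_minus)
      finally show "(\<Sum>k\<in>{0..<q}. (if k = (g - r h) mod q then 1 / 3 else 0) * \<phi> (h, k))
          = 1 / 3 * \<chi> g * (a * inverse (\<chi> (r h)) - 1)"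
        using \<chi>_nz[of "r h"] by (simp add: field_simps)
    qed
    also have "\<dots> = 1 / 3 * \<chi> g * (\<Sum>h\<in>UNIV. a * inverse (\<chi> (r h)) - 1)"
      by (simp only: sum_distrib_left)
    also have "(\<Sum>h\<in>UNIV. a * inverse (\<chi> (r h)) - 1) = a * (z + inverse z + 4) - 6"
      by (simp add: UNIV_loop \<chi>_r algebra_simps)
    also have "\<dots> = 3 * (a ^ 2 - 1)"
      by (simp add: spec)
    \<comment> \<open>The constants cancel: (a^2 - 1) - (a c - 1) = a (a - c) with c the character
      value of the loop.\<close>
    also have "1 / 3 * \<chi> g * (3 * (a ^ 2 - 1)) - \<chi> g * (a * \<chi> (r e') - 1) = a * \<phi> e"
      by (simp add: e \<phi>_def algebra_simps power2_eq_square)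
    finally show ?thesis .
  qed
  \<comment> \<open>A loop of voltage 0 contributes the entry a - 1, which is nonzero by
    hypothesis.\<close>
  have "(S1, 0) \<in> arcs L" "\<phi> (S1, 0) \<noteq> 0"
    using q0 a by (simp_all add: arcs_L \<phi>_def \<chi>_r) (simp add: \<chi>_def)
  thus ?thesis
    unfolding L_def[symmetric] \<iota>_def[symmetric]
    using grover_eigenvalueI[OF fin eig] by blast
qed

lemma P5_root_eigenvalue:
  fixes a :: Q5_bar
  assumes n: "n \<ge> 1" and root: "poly (map_poly to_qbar P5) a = 0"
  shows "U_eigenvalue n a"
proof -
  have "map_poly to_qbar P5 = map_poly to_ac (map_poly to_fract P5)"
    by (simp add: map_poly_map_poly o_def)
  also have "\<dots> = [:1, - (7 / 3), 29 / 9, - (7 / 3), 1:]"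
    by (simp add: P5_fract map_poly_pCons)
  finally have "9 * poly [:1, - (7 / 3), 29 / 9, - (7 / 3), 1:] a = 0"
    using root by simp
  hence P5: "9 * a ^ 4 - 21 * a ^ 3 + 29 * a ^ 2 - 21 * a + 9 = 0"
    by (simp add: algebra_simps eval_nat_numeral)
  \<comment> \<open>The cleared equation would read 9 = 0 at a = 0 and 5 = 0 at a = 1.\<close>
  have a0: "a \<noteq> 0" and a1: "a \<noteq> 1"
    using P5 by auto
  \<comment> \<open>This solves the spectral equation a (w + 4) = 3 (a^2 + 1) for w = z + 1/z; the
    equation of P_5 then becomes w^2 + w - 1 = 0.\<close>
  define w where "w = (3 * a ^ 2 - 4 * a + 3) / a"
  have w: "w * a = 3 * a ^ 2 - 4 * a + 3"
    using a0 by (simp add: w_def)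
  have "a ^ 2 * (w ^ 2 + w - 1) = (w * a) ^ 2 + a * (w * a) - a ^ 2"
    by (simp add: algebra_simps power2_eq_square)
  also have "\<dots> = 9 * a ^ 4 - 21 * a ^ 3 + 29 * a ^ 2 - 21 * a + 9"
    unfolding w by (simp add: algebra_simps eval_nat_numeral)
  finally have w_root: "w ^ 2 + w - 1 = 0"
    using P5 a0 by simp
  have "degree [:1, - w, 1:] > 0" by simp
  then obtain z where "poly [:1, - w, 1:] z = 0"
    using alg_closed_imp_poly_has_root by blast
  hence wz: "w * z = z ^ 2 + 1"
    by (simp add: algebra_simps power2_eq_square)
  hence z0: "z \<noteq> 0" by auto
  have "w = (w * z) * inverse z"
    using z0 by simp
  also have "\<dots> = z + inverse z"
    unfolding wz using z0 by (simp add: distrib_right power2_eq_square)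
  finally have w_eq: "w = z + inverse z" .
  have "1 + z + z ^ 2 + z ^ 3 + z ^ 4 = (w * z) ^ 2 + z * (w * z) - z ^ 2"
    unfolding wz by (simp add: algebra_simps eval_nat_numeral)
  also have "\<dots> = z ^ 2 * (w ^ 2 + w - 1)"
    by (simp add: algebra_simps power2_eq_square)
  also have "\<dots> = 0"
    by (simp only: w_root mult_zero_right)
  finally have cyc: "1 + z + z ^ 2 + z ^ 3 + z ^ 4 = 0" .
  have "z ^ 5 - 1 = 0"
    unfolding poly_fifth_cyclotomic_mult[symmetric] cyc by simp
  hence "z ^ 5 = 1" by simp
  moreover have "a * (z + inverse z + 4) = w * a + 4 * a"
    unfolding w_eq by (simp add: algebra_simps)
  hence "a * (z + inverse z + 4) = 3 * (a ^ 2 + 1)"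
    unfolding w by (simp add: algebra_simps)
  ultimately show ?thesis
    using layer_eigenvalue[OF n _ a1] by blast
qed

subsection \<open>Zeros at roots of unity\<close>

lemma R_X_zero_iff:
  fixes \<zeta> :: Q5_bar
  assumes F: "fps_of_poly R_denom * F = fps_of_poly R_numer"
    and \<zeta>: "\<zeta> \<in> p_power_roots_of_unity"
  shows "(\<exists>!s. fps_padic_sums F (\<zeta> - 1) s) \<and>
    (fps_padic_eval F (\<zeta> - 1) = 0 \<longleftrightarrow> primitive_root_of_unity 5 \<zeta>)"
proof -
  obtain m where m: "\<zeta> ^ (5 ^ m) = 1"
    using \<zeta> by (auto simp: p_power_roots_of_unity_def roots_of_unity_def CARD_five)
  hence \<zeta>0: "\<zeta> \<noteq> 0" by (auto simp: power_0_left)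
  note sums = R_X_evaluation[OF F m]
  have "fps_padic_eval F (\<zeta> - 1) = (1 + \<zeta> + \<zeta> ^ 2 + \<zeta> ^ 3 + \<zeta> ^ 4) ^ 2 / (81 * \<zeta> ^ 4)"
    unfolding fps_padic_eval_def using sums fps_padic_sums_unique by (intro the_equality)
  hence "fps_padic_eval F (\<zeta> - 1) = 0 \<longleftrightarrow> primitive_root_of_unity 5 \<zeta>"
    using \<zeta>0 by (simp add: primitive_fifth_root_iff)
  thus ?thesis
    using sums fps_padic_sums_unique by blast
qed

theorem proposition7p12:
  shows
    "poly P5 1 = 5 / 9 \<and> poly P5 (-1) = 89 / 9 \<and>
     coprime (map_poly to_fract P5 :: Q5 poly) ([:0, 1:] ^ 2 - 1) \<and>
     R_X P5 = poly (map_poly of_int (cyclotomic 5)) z_elem ^ 2 / (81 * z_elem ^ 4) \<and>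
     (\<exists>F :: Z5 fps. to_fract F = R_X P5 \<and> F \<noteq> 0 \<and> mu_inv F = 0 \<and> lambda_inv F = 8 \<and>
        (\<forall>\<zeta>\<in>p_power_roots_of_unity.
           (\<exists>!s. fps_padic_sums F (\<zeta> - 1) s) \<and>
           (fps_padic_eval F (\<zeta> - 1) = 0 \<longleftrightarrow> primitive_root_of_unity 5 \<zeta>)) \<and>
        \<not> (\<forall>\<zeta>\<in>p_power_roots_of_unity. fps_padic_eval F (\<zeta> - 1) \<noteq> 0)) \<and>
     (\<forall>n. {\<zeta> :: Q5_bar. primitive_root_of_unity 5 \<zeta>} \<subseteq> roots_of_unity (5 ^ n) \<longrightarrow>
        (\<forall>a :: Q5_bar. poly (map_poly to_qbar P5) a = 0 \<longrightarrow> U_eigenvalue n a)) \<and>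
     (\<forall>n\<ge>1. \<forall>a :: Q5_bar. poly (map_poly to_qbar P5) a = 0 \<longrightarrow> U_eigenvalue n a)"
proof -
  obtain F where F: "fps_of_poly R_denom * F = fps_of_poly R_numer" "to_fract F = R_X P5"
    by (rule R_X_power_series)
  obtain \<zeta> :: Q5_bar where \<zeta>: "primitive_root_of_unity 5 \<zeta>"
    using exists_primitive_fifth_root by blast
  have \<zeta>5: "\<zeta> ^ 5 = 1" "\<zeta> \<noteq> 1"
    using \<zeta> unfolding primitive_root_of_unity_def by (blast, force)
  have "\<zeta> \<in> roots_of_unity (CARD(five) ^ 1)"
    using \<zeta>5 by (simp add: roots_of_unity_def CARD_five)
  hence \<zeta>_mem: "\<zeta> \<in> p_power_roots_of_unity"
    unfolding p_power_roots_of_unity_def by blast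
  have "R_numer \<noteq> 0"
    by (simp add: R_numer_def)
  hence F_nonzero: "F \<noteq> 0"
    using F(1) by (metis fps_of_poly_0 fps_of_poly_eq_iff mult_zero_right)
  have resultant: "R_X P5 = poly (map_poly of_int (cyclotomic 5)) z_elem ^ 2 / (81 * z_elem ^ 4)"
    by (simp only: R_X_P5 poly_cyclotomic_5)
  \<comment> \<open>Level 0 has only the trivial character, whereas primitive fifth roots of unity
    exist and differ from 1.\<close>
  have level: "n \<ge> 1" if "{\<zeta> :: Q5_bar. primitive_root_of_unity 5 \<zeta>} \<subseteq> roots_of_unity (5 ^ n)" for n
  proof (rule ccontr)
    assume "\<not> n \<ge> 1"
    hence "n = 0" by simp
    moreover have "\<zeta> \<in> roots_of_unity (5 ^ n)"
      using that \<zeta> by blast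
    ultimately show False
      using \<zeta>5(2) by (simp add: roots_of_unity_def)
  qed
  have zeros: "\<forall>\<zeta>\<in>p_power_roots_of_unity. (\<exists>!s. fps_padic_sums F (\<zeta> - 1) s) \<and>
      (fps_padic_eval F (\<zeta> - 1) = 0 \<longleftrightarrow> primitive_root_of_unity 5 \<zeta>)"
    using R_X_zero_iff[OF F(1)] by blast
  hence "\<not> (\<forall>\<zeta>\<in>p_power_roots_of_unity. fps_padic_eval F (\<zeta> - 1) \<noteq> 0)"
    using \<zeta> \<zeta>_mem by blast
  hence "\<exists>F :: Z5 fps. to_fract F = R_X P5 \<and> F \<noteq> 0 \<and> mu_inv F = 0 \<and> lambda_inv F = 8 \<and>
        (\<forall>\<zeta>\<in>p_power_roots_of_unity.
           (\<exists>!s. fps_padic_sums F (\<zeta> - 1) s) \<and>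
           (fps_padic_eval F (\<zeta> - 1) = 0 \<longleftrightarrow> primitive_root_of_unity 5 \<zeta>)) \<and>
        \<not> (\<forall>\<zeta>\<in>p_power_roots_of_unity. fps_padic_eval F (\<zeta> - 1) \<noteq> 0)"
    using F(2) F_nonzero R_X_invariants[OF F(1)] zeros by blast
  thus ?thesis
    using P5_at_1 P5_at_minus_1 P5_coprime resultant level P5_root_eigenvalue by blast
qed

end
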